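(* Let $X_1, X_2, \ldots$ be iid real random variables with density $f$, such that $P(X_1>0)>0$. Suppose $f$ satisfies the following conditions. 1) $f$ is bounded and continuous on $\mathbb{R}$ and there is $\gamma>0$ such that $\limsup_{x\to\infty} x^{1+\gamma} f(x)<\infty$. 2) $z f(z)$ has a unique maximizer $z_0>0$. 3) $h := \log f$ is three times differentiable on $\mathbb{R}$, such that $\sup_{x\in\mathbb{R}} |h''(x)|<\infty$ and $\sup_{x\in\mathbb{R}} |h'''(x)|<\infty$. Let $a_n\to\infty$ be such that $a_n^4 = o(n/\log n)$. Let $p\in(0,1)$ and $\alpha\in(0,1)$ be fixed. For $u>0$, let $k_*(u)$ be the minimum $n$ in order for $$R_n(u) \ge (1/p-1)(1/\alpha-1)$$ to hold. Then $$k_*(u) \sim \frac{z_0}{u}\,\ln\left[(1/p-1)(1/\alpha-1)\right], \qquad \text{as } u\to 0+ .$$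
   Context: For each $n$, let $$\bar X = \frac{1}{n}\sum_{i=1}^n X_i, \qquad V = \left[\frac{1}{n}\sum_{i=1}^n (X_i-\bar X)^2\right]^{1/2}$$ (both depending on $n$), and for $u>0$ let $$R_n(u) = \frac{P\left(\sqrt{n}(\bar X+u)\ge x_n V\right)}{P\left(\sqrt{n}\,\bar X\ge x_n V\right)}, \qquad x_n = a_n\sqrt{n},$$ i.e. $R_n(u) = P(\bar X+u\ge a_n V)/P(\bar X\ge a_n V)$. The notation $A(u)\sim B(u)$ as $u\to0+$ means $A(u)/B(u)\to 1$.
   Formalization: The formal theorem adds the hypothesis (1/p-1)(1/α-1) > 1, i.e. p+α < 1; otherwise R_n(u) ≥ 1 gives k_*(u) = 1 for every u > 0 while (z_0/u) ln[(1/p-1)(1/α-1)] ≤ 0, so the claim fails. *)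

theory Defs
  imports "HOL-Probability.Probability" "HOL-Library.Landau_Symbols"
begin

text \<open>Samples are indexed from 1: the data are \<open>X 1, \<dots>, X n\<close>, and \<open>X 0\<close> is never used.\<close>

definition sample_mean :: "(nat \<Rightarrow> 'a \<Rightarrow> real) \<Rightarrow> nat \<Rightarrow> 'a \<Rightarrow> real" where
  "sample_mean X n \<omega> = (\<Sum>i=1..n. X i \<omega>) / real n"

definition sample_sd :: "(nat \<Rightarrow> 'a \<Rightarrow> real) \<Rightarrow> nat \<Rightarrow> 'a \<Rightarrow> real" where
  "sample_sd X n \<omega> = sqrt ((\<Sum>i=1..n. (X i \<omega> - sample_mean X n \<omega>)\<^sup>2) / real n)"

definition shift_tail_prob ::
    "'a measure \<Rightarrow> (nat \<Rightarrow> 'a \<Rightarrow> real) \<Rightarrow> (nat \<Rightarrow> real) \<Rightarrow> nat \<Rightarrow> real \<Rightarrow> real" where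
  "shift_tail_prob M X x n u =
     \<P>(\<omega> in M. sqrt (real n) * (sample_mean X n \<omega> + u) \<ge> x n * sample_sd X n \<omega>)"

definition tail_ratio ::
    "'a measure \<Rightarrow> (nat \<Rightarrow> 'a \<Rightarrow> real) \<Rightarrow> (nat \<Rightarrow> real) \<Rightarrow> nat \<Rightarrow> real \<Rightarrow> real" where
  "tail_ratio M X x n u = shift_tail_prob M X x n u / shift_tail_prob M X x n 0"

text \<open>Sample sizes start at 1. If no sample size reaches the threshold \<open>c\<close>, the value is
  unspecified, so statements about it should be accompanied by an existence claim.\<close>

definition k_star ::
    "'a measure \<Rightarrow> (nat \<Rightarrow> 'a \<Rightarrow> real) \<Rightarrow> (nat \<Rightarrow> real) \<Rightarrow> real \<Rightarrow> real \<Rightarrow> nat" where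
  "k_star M X x c u = (LEAST n. 1 \<le> n \<and> tail_ratio M X x n u \<ge> c)"

end

theory Submission imports Defs begin

text \<open>
The event \<open>sqrt n * mean \<ge> x\<^sub>n * deviation\<close> with \<open>x\<^sub>n = a\<^sub>n sqrt n\<close> says that the sample lies in the cone
\<open>a\<^sub>n * deviation \<le> mean\<close> around the diagonal of \<open>n\<close>-space. As \<open>a\<^sub>n\<close> grows the cone narrows, so on
it the observations are close, in the mean square, to their mean \<open>m\<close>, and for bounded \<open>m\<close> the joint
density is \<open>f m ^ n\<close> up to a factor \<open>exp (o(n))\<close>. The cone is invariant under dilations, so Lebesgue measure on it induces on the mean
a density proportional to \<open>m ^ (n - 1)\<close> (\<open>nn_integral_cone\<close>). Together the mean has, conditionally
on the event, a density proportional to \<open>(m * f m) ^ n\<close> up to such a factor, and it concentrates at the maximizer \<open>z\<^sub>0\<close>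
of \<open>z * f z\<close> (\<open>cone_mass_far_negligible\<close>). The unknown volume of the cone cancels in every comparison.

Shifting the sample by \<open>u = t / n\<close> replaces \<open>f x\<close> by \<open>f (x - u)\<close>. At a sample in the cone with mean
near \<open>z\<^sub>0\<close> this multiplies the joint density by \<open>exp (- n u h' m)\<close>, with \<open>h = ln \<circ> f\<close>, up to a factor
close to 1: here the factor \<open>exp (o(n))\<close> above is common to both densities, and what remains is of
order \<open>n u\<^sup>2 + n u / a\<^sub>n\<^sup>2\<close> by the bounds on \<open>h''\<close> and \<open>h'''\<close> (\<open>shift_log_ratio\<close>). The first-order
condition at \<open>z\<^sub>0\<close> is \<open>h' z\<^sub>0 = - 1 / z\<^sub>0\<close>. Hence \<open>R\<^sub>n (t / n) \<longlonglongrightarrow> exp (t / z\<^sub>0)\<close> for every \<open>t > 0\<close>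
(\<open>shifted_probability_ratio\<close>).

Finally \<open>R\<^sub>n u\<close> is increasing in \<open>u\<close>, because the event is, and for each single \<open>n\<close> it is below
the threshold \<open>c > 1\<close> for small \<open>u\<close>. These facts turn the limit at \<open>u = t / n\<close> into the asymptotics of the first
\<open>n\<close> with \<open>R\<^sub>n u \<ge> c\<close>: it is the \<open>n\<close> with \<open>exp (n u / z\<^sub>0) \<sim> c\<close> (\<open>first_passage_asymptotics\<close>).
\<close>

section \<open>Sample mean and deviation as functions on the sample space\<close>

(* Keeps the index range in the form {1..n} that the sample statistics use. *)
declare One_nat_def [simp del]

abbreviation lebesgue_prod :: "nat \<Rightarrow> (nat \<Rightarrow> real) measure" where
  "lebesgue_prod n \<equiv> Pi\<^sub>M {1..n} (\<lambda>_. lborel)"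

abbreviation avg :: "nat \<Rightarrow> (nat \<Rightarrow> real) \<Rightarrow> real" where
  "avg n \<equiv> sample_mean (\<lambda>i x. x i) n"

abbreviation sd :: "nat \<Rightarrow> (nat \<Rightarrow> real) \<Rightarrow> real" where
  "sd n \<equiv> sample_sd (\<lambda>i x. x i) n"

section \<open>Lebesgue measure of the cone of nearly constant samples\<close>

text \<open>The dilation by \<open>c\<close> multiplies the length of each side of a box by \<open>c\<close>, and boxes determine the
  product measure. The product space has functions on \<open>I\<close> as points, so the number of factors can
  vary with the sample size.\<close>

lemma emeasure_PiM_lborel_scale:
  fixes c :: real
  assumes I: "finite I" and c: "0 < c" and A: "A \<in> sets (Pi\<^sub>M I (\<lambda>_. lborel))"
  shows "emeasure (Pi\<^sub>M I (\<lambda>_. lborel)) A =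
    ennreal (c ^ card I) * emeasure (Pi\<^sub>M I (\<lambda>_. lborel)) {x \<in> space (Pi\<^sub>M I (\<lambda>_. lborel)). (\<lambda>i\<in>I. c * x i) \<in> A}"
proof -
  let ?L = "Pi\<^sub>M I (\<lambda>_. lborel :: real measure)"
  let ?T = "\<lambda>x. \<lambda>i\<in>I. c * x i"
  interpret L: product_sigma_finite "\<lambda>_. lborel :: real measure"
    by standard
  have T[measurable]: "?T \<in> measurable ?L ?L"
    by (intro measurable_restrict) simp
  have "density (distr ?L ?L ?T) (\<lambda>_. ennreal (c ^ card I)) = ?L"
  proof (rule L.PiM_eqI[OF I])
    show "sets (density (distr ?L ?L ?T) (\<lambda>_. ennreal (c ^ card I))) = sets ?L" by simp
  next
    fix B :: "'a \<Rightarrow> real set" assume B[measurable]: "\<And>i. i \<in> I \<Longrightarrow> B i \<in> sets lborel"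
    have PB[measurable]: "Pi\<^sub>E I B \<in> sets ?L" using I B by (intro sets_PiM_I_finite) auto
    have pre: "?T -` Pi\<^sub>E I B \<inter> space ?L = (\<Pi>\<^sub>E i\<in>I. (*) c -` B i)"
      by (auto simp: space_PiM PiE_def Pi_def extensional_def)
    have vim[measurable]: "(*) c -` B i \<in> sets lborel" if "i \<in> I" for i
      using measurable_sets[of "(*) c" lborel borel "B i"] B[OF that] by simp
    have sc: "emeasure lborel (B i) = ennreal c * emeasure lborel ((*) c -` B i)" if "i \<in> I" for i
    proof -
      have "emeasure lborel (B i) = emeasure (density (distr lborel borel ((*) c)) (\<lambda>_. ennreal \<bar>c\<bar>)) (B i)"
        using c by (subst lborel_distr_mult'[of c]) auto
      also have "\<dots> = ennreal c * emeasure (distr lborel borel ((*) c)) (B i)"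
        using B[OF that] c by (subst emeasure_density) (auto simp: nn_integral_cmult_indicator)
      finally show ?thesis
        using B[OF that] by (simp add: emeasure_distr)
    qed
    have "emeasure (density (distr ?L ?L ?T) (\<lambda>_. ennreal (c ^ card I))) (Pi\<^sub>E I B)
      = ennreal (c ^ card I) * emeasure (distr ?L ?L ?T) (Pi\<^sub>E I B)"
      by (subst emeasure_density) (auto simp: nn_integral_cmult_indicator)
    also have "\<dots> = ennreal (c ^ card I) * (\<Prod>i\<in>I. emeasure lborel ((*) c -` B i))"
      using I vim by (subst emeasure_distr) (simp_all add: pre L.emeasure_PiM)
    also have "\<dots> = (\<Prod>i\<in>I. ennreal c * emeasure lborel ((*) c -` B i))"
      using c by (simp add: prod.distrib ennreal_power)
    also have "\<dots> = (\<Prod>i\<in>I. emeasure lborel (B i))"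
      by (intro prod.cong) (auto simp: sc)
    finally show "emeasure (density (distr ?L ?L ?T) (\<lambda>_. ennreal (c ^ card I))) (Pi\<^sub>E I B)
      = (\<Prod>i\<in>I. emeasure lborel (B i))" .
  qed
  then have "emeasure ?L A = emeasure (density (distr ?L ?L ?T) (\<lambda>_. ennreal (c ^ card I))) A"
    by simp
  also have "\<dots> = ennreal (c ^ card I) * emeasure (distr ?L ?L ?T) A"
    using A by (subst emeasure_density) (auto simp: nn_integral_cmult_indicator)
  also have "emeasure (distr ?L ?L ?T) A = emeasure ?L {x \<in> space ?L. ?T x \<in> A}"
    using A by (subst emeasure_distr) (auto intro!: arg_cong[where f="emeasure ?L"])
  finally show ?thesis .
qed

text \<open>The samples whose t-statistic is large; \<open>a\<close> is the threshold divided by \<open>\<surd>n\<close>.\<close>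

definition student_cone :: "nat \<Rightarrow> real \<Rightarrow> (nat \<Rightarrow> real) set" where
  "student_cone n a = {x \<in> space (lebesgue_prod n). a * sd n x \<le> avg n x}"

lemma avg_measurable[measurable]: "avg n \<in> borel_measurable (lebesgue_prod n)"
  unfolding sample_mean_def by measurable

lemma sd_measurable[measurable]: "sd n \<in> borel_measurable (lebesgue_prod n)"
  unfolding sample_sd_def by measurable

lemma cone_measurable[measurable]: "student_cone n a \<in> sets (lebesgue_prod n)"
  unfolding student_cone_def by measurable

lemma sd_nonneg: "0 \<le> sd n x"
  unfolding sample_sd_def by (simp add: sum_nonneg)

lemma sum_deviation_eq_0: "1 \<le> n \<Longrightarrow> (\<Sum>i=1..n. x i - avg n x) = 0"
  by (simp add: sum_subtractf sample_mean_def)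

lemma sum_deviation_sq: "1 \<le> n \<Longrightarrow> (\<Sum>i=1..n. (x i - avg n x)\<^sup>2) = real n * (sd n x)\<^sup>2"
  by (simp add: sample_sd_def sum_nonneg)

lemma avg_scale: "avg n (\<lambda>i\<in>{1..n}. c * x i) = c * avg n x"
  by (simp add: sample_mean_def sum_distrib_left)

lemma sd_scale:
  assumes "0 \<le> c" shows "sd n (\<lambda>i\<in>{1..n}. c * x i) = c * sd n x"
proof -
  have "(\<Sum>i=1..n. ((\<lambda>i\<in>{1..n}. c * x i) i - c * avg n x)\<^sup>2) = c\<^sup>2 * (\<Sum>i=1..n. (x i - avg n x)\<^sup>2)"
    unfolding sum_distrib_left
    by (intro sum.cong) (auto simp: power2_eq_square algebra_simps)
  then show ?thesis
    using assms by (simp add: sample_sd_def avg_scale real_sqrt_mult real_sqrt_divide)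
qed

lemma cone_avg_nonneg: "0 < a \<Longrightarrow> x \<in> student_cone n a \<Longrightarrow> 0 \<le> avg n x"
  using sd_nonneg[of n x] by (auto simp: student_cone_def intro: order_trans[rotated])

lemma cone_sd_le: "0 < a \<Longrightarrow> x \<in> student_cone n a \<Longrightarrow> sd n x \<le> avg n x / a"
  by (simp add: student_cone_def field_simps)

lemma cone_deviation_le:
  assumes n: "1 \<le> n" and a: "0 < a" and x: "x \<in> student_cone n a"
  shows "(\<Sum>i=1..n. (x i - avg n x)\<^sup>2) \<le> real n * (avg n x)\<^sup>2 / a\<^sup>2"
proof -
  have "(sd n x)\<^sup>2 \<le> (avg n x / a)\<^sup>2"
    by (intro power_mono cone_sd_le a x sd_nonneg)
  then have "real n * (sd n x)\<^sup>2 \<le> real n * (avg n x / a)\<^sup>2"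
    by (intro mult_left_mono) auto
  then show ?thesis
    by (simp add: sum_deviation_sq[OF n] power_divide)
qed

text \<open>Only two facts about this constant matter: it is finite and positive. Its value, that of a ball
  times powers of \<open>a\<close> and \<open>n\<close>, cancels in all ratios.\<close>

definition cone_volume :: "nat \<Rightarrow> real \<Rightarrow> real" where
  "cone_volume n a = measure (lebesgue_prod n) {x \<in> student_cone n a. avg n x < 1}"

lemma emeasure_box:
  "emeasure (lebesgue_prod n) (\<Pi>\<^sub>E i\<in>{1..n}. {l..r}) = ennreal (r - l) ^ n" if "l \<le> r"
proof -
  interpret L: product_sigma_finite "\<lambda>_. lborel :: real measure"
    by standard
  show ?thesis
    using that by (subst L.emeasure_PiM) auto
qed

text \<open>Finite because a deviation of at most \<open>1 / a\<close> confines every coordinate to a bounded interval;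
  positive because the cone contains a small cube around the constant sample \<open>1 / 2\<close>.\<close>

lemma emeasure_cone_avg_less_1:
  assumes n: "1 \<le> n" and a: "0 < a"
  shows "emeasure (lebesgue_prod n) {x \<in> student_cone n a. avg n x < 1} = ennreal (cone_volume n a)"
    and "0 < cone_volume n a"
proof -
  let ?L = "lebesgue_prod n"
  let ?C = "{x \<in> student_cone n a. avg n x < 1}"
  have C: "?C \<in> sets ?L" by measurable
  have "?C \<subseteq> (\<Pi>\<^sub>E i\<in>{1..n}. {- sqrt (real n) / a .. 1 + sqrt (real n) / a})"
  proof
    fix x assume "x \<in> ?C"
    then have x: "x \<in> student_cone n a" and m1: "avg n x < 1" by auto
    have m0: "0 \<le> avg n x" by (rule cone_avg_nonneg[OF a x])
    have "x i \<in> {- sqrt (real n) / a .. 1 + sqrt (real n) / a}" if i: "i \<in> {1..n}" for i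
    proof -
      have "(x i - avg n x)\<^sup>2 \<le> (\<Sum>i=1..n. (x i - avg n x)\<^sup>2)"
        using i by (intro member_le_sum) auto
      also have "\<dots> \<le> real n * (avg n x)\<^sup>2 / a\<^sup>2"
        by (rule cone_deviation_le[OF n a x])
      also have "\<dots> \<le> real n * 1\<^sup>2 / a\<^sup>2"
        using m0 m1 by (intro divide_right_mono mult_left_mono power_mono) auto
      also have "\<dots> = (sqrt (real n) / a)\<^sup>2"
        by (simp add: power_divide)
      finally have "\<bar>x i - avg n x\<bar> \<le> sqrt (real n) / a"
        using a by (metis abs_le_square_iff abs_of_nonneg divide_nonneg_pos of_nat_0_le_iff real_sqrt_ge_zero)
      then show ?thesis using m0 m1 by (auto simp: abs_le_iff)
    qed
    moreover have "x \<in> extensional {1..n}"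
      using x by (auto simp: student_cone_def space_PiM PiE_def)
    ultimately show "x \<in> (\<Pi>\<^sub>E i\<in>{1..n}. {- sqrt (real n) / a .. 1 + sqrt (real n) / a})"
      by (simp add: PiE_def Pi_def)
  qed
  then have "emeasure ?L ?C \<le> emeasure ?L (\<Pi>\<^sub>E i\<in>{1..n}. {- sqrt (real n) / a .. 1 + sqrt (real n) / a})"
    by (intro emeasure_mono sets_PiM_I_finite) auto
  also have "\<dots> < \<infinity>"
    using a by (subst emeasure_box) (auto simp: power_less_top_ennreal)
  finally show eq: "emeasure ?L ?C = ennreal (cone_volume n a)"
    unfolding cone_volume_def by (intro emeasure_eq_ennreal_measure) auto

  \<comment> \<open>A cube of half-side \<open>d\<close> around \<open>1/2\<close> has deviation at most \<open>2 * d\<close> and mean at least \<open>1/2 - d\<close>.\<close>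
  define d where "d = 1 / (4 * (a + 1))"
  have d: "0 < d" "d \<le> 1/4" "a * (2 * d) \<le> 1/2 - d"
    using a by (auto simp: d_def field_simps)
  have "(\<Pi>\<^sub>E i\<in>{1..n}. {1/2 - d .. 1/2 + d}) \<subseteq> ?C"
  proof
    fix x assume x: "x \<in> (\<Pi>\<^sub>E i\<in>{1..n}. {1/2 - d .. 1/2 + d})"
    then have xi: "1/2 - d \<le> x i" "x i \<le> 1/2 + d" if "i \<in> {1..n}" for i
      using that by (auto simp: PiE_def Pi_def)
    have "real n * (1/2 - d) \<le> (\<Sum>i=1..n. x i)"
      using sum_mono[of "{1..n}" "\<lambda>_. 1/2 - d" x] xi by simp
    then have m1: "1/2 - d \<le> avg n x"
      using n by (simp add: sample_mean_def field_simps)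
    have "(\<Sum>i=1..n. x i) \<le> real n * (1/2 + d)"
      using sum_mono[of "{1..n}" x "\<lambda>_. 1/2 + d"] xi by simp
    then have m2: "avg n x \<le> 1/2 + d"
      using n by (simp add: sample_mean_def field_simps)
    have "(x i - avg n x)\<^sup>2 \<le> (2 * d)\<^sup>2" if "i \<in> {1..n}" for i
      using xi[OF that] m1 m2 d by (intro power2_le_iff_abs_le[THEN iffD2]) auto
    then have "(\<Sum>i=1..n. (x i - avg n x)\<^sup>2) \<le> real n * (2 * d)\<^sup>2"
      using sum_mono[of "{1..n}" "\<lambda>i. (x i - avg n x)\<^sup>2" "\<lambda>_. (2 * d)\<^sup>2"] by simp
    then have "(sd n x)\<^sup>2 \<le> (2 * d)\<^sup>2"
      using n by (simp add: sum_deviation_sq)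
    then have "sd n x \<le> 2 * d"
      using d by (auto intro: power2_le_imp_le[of "sd n x"])
    then have "a * sd n x \<le> a * (2 * d)"
      using a by (intro mult_left_mono) auto
    then have "a * sd n x \<le> avg n x" using d m1 by linarith
    then show "x \<in> ?C"
      using x m2 d by (auto simp: student_cone_def space_PiM PiE_def)
  qed
  then have "emeasure ?L (\<Pi>\<^sub>E i\<in>{1..n}. {1/2 - d .. 1/2 + d}) \<le> emeasure ?L ?C"
    using C by (intro emeasure_mono)
  moreover have "emeasure ?L (\<Pi>\<^sub>E i\<in>{1..n}. {1/2 - d .. 1/2 + d}) = ennreal (2 * d) ^ n"
    using d by (subst emeasure_box) auto
  moreover have "0 < ennreal (2 * d) ^ n"
    using d by (simp add: ennreal_power)
  ultimately show "0 < cone_volume n a"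
    unfolding eq by (metis ennreal_less_zero_iff order_less_le_trans)
qed

lemma cone_scale_iff:
  assumes "0 < s" "x \<in> space (lebesgue_prod n)"
  shows "(\<lambda>i\<in>{1..n}. s * x i) \<in> student_cone n a \<longleftrightarrow> x \<in> student_cone n a"
proof -
  have "a * (s * sd n x) \<le> s * avg n x \<longleftrightarrow> a * sd n x \<le> avg n x"
    using assms(1) mult_le_cancel_left_pos[of s "a * sd n x" "avg n x"] by (simp add: mult.left_commute)
  then show ?thesis
    using assms unfolding student_cone_def by (auto simp: avg_scale sd_scale space_PiM)
qed

lemma emeasure_cone_avg_less:
  assumes n: "1 \<le> n" and a: "0 < a" and s: "0 < s"
  shows "emeasure (lebesgue_prod n) {x \<in> student_cone n a. avg n x < s} = ennreal (s ^ n * cone_volume n a)"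
proof -
  have "emeasure (lebesgue_prod n) {x \<in> student_cone n a. avg n x < s} = ennreal (s ^ n) *
    emeasure (lebesgue_prod n) {x \<in> space (lebesgue_prod n). (\<lambda>i\<in>{1..n}. s * x i) \<in> {x \<in> student_cone n a. avg n x < s}}"
    by (subst emeasure_PiM_lborel_scale[OF _ s]) simp_all
  also have "{x \<in> space (lebesgue_prod n). (\<lambda>i\<in>{1..n}. s * x i) \<in> {x \<in> student_cone n a. avg n x < s}}
     = {x \<in> student_cone n a. avg n x < 1}"
    using s cone_scale_iff[OF s] by (auto simp: avg_scale student_cone_def)
  finally show ?thesis
    using emeasure_cone_avg_less_1[OF n a] s by (simp add: ennreal_mult)
qed

lemma nn_integral_power_Iio:
  assumes n: "1 \<le> n" and w: "0 \<le> w" and s: "0 < s"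
  shows "(\<integral>\<^sup>+z. ennreal (real n * w * z ^ (n - 1)) * indicator {0..} z * indicator {..<s} z \<partial>lborel)
    = ennreal (s ^ n * w)"
proof -
  have "(\<integral>\<^sup>+z. ennreal (real n * w * z ^ (n - 1)) * indicator {0..} z * indicator {..<s} z \<partial>lborel)
    = (\<integral>\<^sup>+z. ennreal (real n * w * z ^ (n - 1)) * indicator {0..s} z \<partial>lborel)"
  proof (intro nn_integral_cong_AE)
    show "AE z in lborel. ennreal (real n * w * z ^ (n - 1)) * indicator {0..} z * indicator {..<s} z =
      ennreal (real n * w * z ^ (n - 1)) * indicator {0..s} z"
      using AE_lborel_singleton[of s] by eventually_elim (auto simp: indicator_def)
  qed
  also have "\<dots> = ennreal (s ^ n * w - 0 ^ n * w)"
  proof (rule nn_integral_FTC_Icc)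
    show "((\<lambda>z. z ^ n * w) has_real_derivative real n * w * x ^ (n - 1)) (at x)" for x
      by (auto intro!: derivative_eq_intros simp flip: One_nat_def)
  qed (use w s in auto)
  finally show ?thesis using n by (simp add: power_0_left)
qed

text \<open>Integration in polar coordinates along the diagonal: by dilation invariance the part of the cone
  with mean below \<open>s\<close> has volume proportional to \<open>s ^ n\<close>, and these half-lines generate the Borel sets.
  Open half-lines are used since the one ending at 0 is then empty, which avoids a separate argument that
  the tip of the cone is a null set.\<close>

lemma nn_integral_cone:
  fixes \<phi> :: "real \<Rightarrow> ennreal"
  assumes n: "1 \<le> n" and a: "0 < a" and \<phi>[measurable]: "\<phi> \<in> borel_measurable borel"
  shows "(\<integral>\<^sup>+x. \<phi> (avg n x) * indicator (student_cone n a) x \<partial>lebesgue_prod n) =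
    (\<integral>\<^sup>+z. \<phi> z * (ennreal (real n * cone_volume n a * z ^ (n - 1)) * indicator {0..} z) \<partial>lborel)"
proof -
  let ?L = "lebesgue_prod n" and ?w = "cone_volume n a"
  let ?d = "\<lambda>z. ennreal (real n * ?w * z ^ (n - 1)) * indicator {0..} z"
  let ?N1 = "distr (density ?L (indicator (student_cone n a))) borel (avg n)"
  let ?N2 = "density lborel ?d"
  have w: "0 \<le> ?w" using emeasure_cone_avg_less_1[OF n a] by simp
  have e1: "emeasure ?N1 {..<s} = emeasure ?L {x \<in> student_cone n a. avg n x < s}" for s
  proof -
    have "emeasure ?N1 {..<s} = emeasure (density ?L (indicator (student_cone n a))) {x \<in> space ?L. avg n x < s}"
      by (subst emeasure_distr) (auto intro!: arg_cong[where f="emeasure _"])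
    also have "\<dots> = emeasure ?L (student_cone n a \<inter> {x \<in> space ?L. avg n x < s})"
      by (subst emeasure_density) (auto simp flip: indicator_inter_arith)
    finally show ?thesis
      by (auto simp: student_cone_def intro!: arg_cong[where f="emeasure _"])
  qed
  have "?N1 = ?N2"
  proof (rule measure_eqI_generator_eq)
    show "Int_stable (range (\<lambda>s::real. {..<s}))"
      proof (clarsimp simp: Int_stable_def)
      fix s t :: real
      have "{..<s} \<inter> {..<t} = {..<min s t}" by auto
      then show "{..<s} \<inter> {..<t} \<in> range lessThan" by blast
    qed
    show "range (\<lambda>s::real. {..<s}) \<subseteq> Pow UNIV" by simp
    show "sets ?N1 = sigma_sets UNIV (range (\<lambda>s::real. {..<s}))"
      by (simp add: borel_Iio)
    show "sets ?N2 = sigma_sets UNIV (range (\<lambda>s::real. {..<s}))"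
      by (simp add: borel_Iio)
    show "range (\<lambda>i::nat. {..<real i}) \<subseteq> range (\<lambda>s::real. {..<s})" by auto
    show "(\<Union>i::nat. {..<real i}) = UNIV"
      using reals_Archimedean2 by auto
  next
    fix S assume "S \<in> range (\<lambda>s::real. {..<s})"
    then obtain s where S: "S = {..<s}" by auto
    show "emeasure ?N1 S = emeasure ?N2 S"
    proof (cases "0 < s")
      case True
      then show ?thesis
        unfolding S e1 emeasure_cone_avg_less[OF n a True]
        by (subst emeasure_density) (auto simp: nn_integral_power_Iio[OF n w True])
    next
      case False
      have "{x \<in> student_cone n a. avg n x < s} = {}"
        using False cone_avg_nonneg[OF a] by force
      moreover have "emeasure ?N2 {..<s} = 0"
      proof -
        have "emeasure ?N2 {..<s} = (\<integral>\<^sup>+z. ?d z * indicator {..<s} z \<partial>lborel)"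
          by (subst emeasure_density) auto
        also have "\<dots> = (\<integral>\<^sup>+(z::real). 0 \<partial>lborel)"
          using False by (intro nn_integral_cong) (auto simp: indicator_def)
        finally show ?thesis by simp
      qed
      ultimately show ?thesis unfolding S e1 by (simp only: emeasure_empty)
    qed
  next
    fix i :: nat
    have "{x \<in> student_cone n a. avg n x < 0} = {}"
      using cone_avg_nonneg[OF a] by force
    then have "emeasure ?L {x \<in> student_cone n a. avg n x < 0} = 0"
      by (simp only: emeasure_empty)
    then show "emeasure ?N1 {..<real i} \<noteq> \<infinity>"
      unfolding e1 by (cases "i = 0") (auto simp: emeasure_cone_avg_less[OF n a])
  qed
  then have "integral\<^sup>N ?N1 \<phi> = integral\<^sup>N ?N2 \<phi>" by simp
  moreover have "integral\<^sup>N ?N1 \<phi> = (\<integral>\<^sup>+x. indicator (student_cone n a) x * \<phi> (avg n x) \<partial>?L)"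
    by (simp add: nn_integral_distr nn_integral_density)
  moreover have "integral\<^sup>N ?N2 \<phi> = (\<integral>\<^sup>+z. ?d z * \<phi> z \<partial>lborel)"
    by (rule nn_integral_density) auto
  ultimately show ?thesis
    by (simp only: mult.commute)
qed

section \<open>Second-order Taylor bounds for sums around the mean\<close>

lemma quadratic_taylor_bound:
  fixes g g' g'' :: "real \<Rightarrow> real"
  assumes g: "\<And>x. (g has_real_derivative g' x) (at x)"
    and g': "\<And>x. (g' has_real_derivative g'' x) (at x)"
    and B: "\<And>x. \<bar>g'' x\<bar> \<le> B"
  shows "\<bar>g y - (g m + g' m * (y - m))\<bar> \<le> B / 2 * (y - m)\<^sup>2"
proof (cases "y = m")
  case False
  define diff where "diff = (\<lambda>k::nat. if k = 0 then g else if k = 1 then g' else g'')"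
  have "\<exists>t. (if y < m then y < t \<and> t < m else m < t \<and> t < y) \<and>
      g y = (\<Sum>k<2. diff k m / fact k * (y - m) ^ k) + diff 2 t / fact 2 * (y - m) ^ 2"
  proof (rule Taylor[where a = "min y m" and b = "max y m"])
    show "\<forall>k t. k < 2 \<and> min y m \<le> t \<and> t \<le> max y m \<longrightarrow> DERIV (diff k) t :> diff (Suc k) t"
      using g g' by (auto simp: diff_def less_2_cases_iff)
  qed (use False in \<open>auto simp: diff_def\<close>)
  then obtain t where "g y = (\<Sum>k<2. diff k m / fact k * (y - m) ^ k) + diff 2 t / fact 2 * (y - m) ^ 2"
    by blast
  then have "g y - (g m + g' m * (y - m)) = g'' t / 2 * (y - m)\<^sup>2"
    by (simp add: diff_def numeral_2_eq_2 lessThan_Suc)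
  then have "\<bar>g y - (g m + g' m * (y - m))\<bar> = \<bar>g'' t / 2 * (y - m)\<^sup>2\<bar>"
    by (simp only:)
  also have "\<dots> = \<bar>g'' t\<bar> / 2 * (y - m)\<^sup>2"
    by (simp add: abs_mult)
  also have "\<dots> \<le> B / 2 * (y - m)\<^sup>2"
    using B[of t] by (intro mult_right_mono divide_right_mono) auto
  finally show ?thesis .
qed (use order_trans[OF abs_ge_zero B] in auto)

text \<open>Expanding around the mean kills the linear terms, so only the sum of squared deviations remains.
  A common shift \<open>u\<close> is included because both the shifted density and the score are needed.\<close>

lemma sum_taylor_bound:
  fixes g g' g'' :: "real \<Rightarrow> real"
  assumes g: "\<And>x. (g has_real_derivative g' x) (at x)"
    and g': "\<And>x. (g' has_real_derivative g'' x) (at x)"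
    and B: "\<And>x. \<bar>g'' x\<bar> \<le> B" and n: "1 \<le> n"
  shows "\<bar>(\<Sum>i=1..n. g (x i - u)) - real n * (g (avg n x) - u * g' (avg n x))\<bar>
    \<le> B / 2 * ((\<Sum>i=1..n. (x i - avg n x)\<^sup>2) + real n * u\<^sup>2)"
proof -
  define m where "m = avg n x"
  have dev: "(\<Sum>i=1..n. x i - m) = 0" unfolding m_def by (rule sum_deviation_eq_0[OF n])
  have lin: "(\<Sum>i=1..n. g m + g' m * (x i - u - m)) = real n * (g m - u * g' m)"
  proof -
    have "(\<Sum>i=1..n. g m + g' m * (x i - u - m)) = (\<Sum>i=1..n. g' m * (x i - m) + (g m - u * g' m))"
      by (intro sum.cong) (auto simp: algebra_simps)
    also have "\<dots> = g' m * (\<Sum>i=1..n. x i - m) + real n * (g m - u * g' m)"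
      by (simp add: sum.distrib sum_distrib_left)
    finally show ?thesis using dev by simp
  qed
  have quad: "(\<Sum>i=1..n. (x i - u - m)\<^sup>2) = (\<Sum>i=1..n. (x i - m)\<^sup>2) + real n * u\<^sup>2"
  proof -
    have "(\<Sum>i=1..n. (x i - u - m)\<^sup>2) = (\<Sum>i=1..n. (x i - m)\<^sup>2 - 2 * u * (x i - m) + u\<^sup>2)"
      by (intro sum.cong) (auto simp: power2_eq_square algebra_simps)
    also have "\<dots> = (\<Sum>i=1..n. (x i - m)\<^sup>2) - 2 * u * (\<Sum>i=1..n. x i - m) + real n * u\<^sup>2"
      by (simp add: sum.distrib sum_subtractf flip: sum_distrib_left)
    finally show ?thesis using dev by simp
  qed
  have "\<bar>(\<Sum>i=1..n. g (x i - u)) - real n * (g m - u * g' m)\<bar>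
    = \<bar>\<Sum>i=1..n. g (x i - u) - (g m + g' m * (x i - u - m))\<bar>"
    unfolding sum_subtractf lin ..
  also have "\<dots> \<le> (\<Sum>i=1..n. \<bar>g (x i - u) - (g m + g' m * (x i - u - m))\<bar>)"
    by (rule sum_abs)
  also have "\<dots> \<le> (\<Sum>i=1..n. B / 2 * (x i - u - m)\<^sup>2)"
    by (intro sum_mono quadratic_taylor_bound[OF g g' B])
  also have "\<dots> = B / 2 * ((\<Sum>i=1..n. (x i - m)\<^sup>2) + real n * u\<^sup>2)"
    unfolding quad[symmetric] by (simp add: sum_distrib_left)
  finally show ?thesis unfolding m_def .
qed

section \<open>Pointwise control of the joint density on the cone\<close>

text \<open>The polynomial decay of the right tail is stated for all \<open>x\<close>, so that no threshold has to be carried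
  along; on the left half-line it is a constant bound.\<close>

locale log_smooth_density =
  fixes f h1 h2 h3 :: "real \<Rightarrow> real" and B2 B3 C \<gamma> z0 :: real
  assumes f_pos: "\<And>x. 0 < f x"
    and h1: "\<And>x. ((\<lambda>t. ln (f t)) has_real_derivative h1 x) (at x)"
    and h2: "\<And>x. (h1 has_real_derivative h2 x) (at x)"
    and h3: "\<And>x. (h2 has_real_derivative h3 x) (at x)"
    and B2: "\<And>x. \<bar>h2 x\<bar> \<le> B2"
    and B3: "\<And>x. \<bar>h3 x\<bar> \<le> B3"
    and \<gamma>_pos: "0 < \<gamma>"
    and decay: "\<And>x. f x \<le> C * (1 + max x 0) powr - (1 + \<gamma>)"
    and z0_pos: "0 < z0"
    and maximizer: "\<And>z. z \<noteq> z0 \<Longrightarrow> z * f z < z0 * f z0"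
begin

lemma B2_nonneg: "0 \<le> B2" using B2[of 0] by linarith
lemma B3_nonneg: "0 \<le> B3" using B3[of 0] by linarith

lemma f_eq_exp: "f x = exp (ln (f x))" using f_pos[of x] by simp

lemma f_continuous: "continuous_on S f"
proof -
  have "continuous_on S (\<lambda>x. exp (ln (f x)))"
    using h1 by (intro continuous_intros continuous_at_imp_continuous_on ballI DERIV_isCont) auto
  then show ?thesis by (subst f_eq_exp[abs_def])
qed

lemma f_measurable[measurable]: "f \<in> borel_measurable borel"
  using f_continuous by (rule borel_measurable_continuous_onI)

lemma C_pos: "0 < C"
  using f_pos[of 0] decay[of 0] by simp

lemma h1_maximizer: "h1 z0 = - 1 / z0"
proof -
  define h where "h = (\<lambda>t. ln (f t))"
  let ?g = "\<lambda>z. z * exp (h z)"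
  have h: "(h has_real_derivative h1 z0) (at z0)"
    unfolding h_def by (rule h1)
  have d: "(?g has_real_derivative exp (h z0) + z0 * (exp (h z0) * h1 z0)) (at z0)"
    by (auto intro!: derivative_eq_intros h)
  have "exp (h z0) + z0 * (exp (h z0) * h1 z0) = 0"
  proof (rule DERIV_local_max[OF d, of 1])
    show "\<forall>y. \<bar>z0 - y\<bar> < 1 \<longrightarrow> ?g y \<le> ?g z0"
    proof (intro allI impI)
      fix y show "?g y \<le> ?g z0"
        using maximizer[of y] f_pos by (cases "y = z0") (auto simp: h_def)
    qed
  qed simp
  then have "exp (h z0) * (1 + z0 * h1 z0) = 0" by (simp add: algebra_simps)
  then have "1 + z0 * h1 z0 = 0" by simp
  then show ?thesis using z0_pos by (simp add: field_simps)
qed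

lemma prod_f_eq_exp: "(\<Prod>i=1..n. f (x i - u)) = exp (\<Sum>i=1..n. ln (f (x i - u)))" for n :: nat
  unfolding exp_sum[OF finite_atLeastAtMost] by (intro prod.cong) (auto simp: f_pos)

lemma prod_f_near_diagonal:
  assumes n: "1 \<le> n" and a: "0 < a" and x: "x \<in> student_cone n a"
  shows "\<bar>(\<Sum>i=1..n. ln (f (x i - u))) - real n * (ln (f (avg n x)) - u * h1 (avg n x))\<bar>
    \<le> real n * (B2 / 2 * ((avg n x)\<^sup>2 / a\<^sup>2 + u\<^sup>2))"
proof -
  have "\<bar>(\<Sum>i=1..n. ln (f (x i - u))) - real n * (ln (f (avg n x)) - u * h1 (avg n x))\<bar>
    \<le> B2 / 2 * ((\<Sum>i=1..n. (x i - avg n x)\<^sup>2) + real n * u\<^sup>2)"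
    by (rule sum_taylor_bound[OF h1 h2 B2 n])
  also have "\<dots> \<le> B2 / 2 * (real n * (avg n x)\<^sup>2 / a\<^sup>2 + real n * u\<^sup>2)"
    using cone_deviation_le[OF n a x] B2_nonneg by (intro mult_left_mono add_mono) auto
  finally show ?thesis by (simp add: algebra_simps)
qed

text \<open>Comparing the two joint densities directly, rather than each of them with a power of \<open>f\<close> at the
  mean, gives an error that is small for \<open>u\<close> of order \<open>1 / n\<close>: the error of order \<open>n / a\<^sup>2\<close> in
  \<open>prod_f_near_diagonal\<close> need not be bounded, but here it acquires the factor \<open>u\<close>. The score \<open>h1\<close>
  is averaged over the sample by a second-order expansion, which is where \<open>h3\<close> enters.\<close>

lemma shift_log_ratio:
  assumes n: "1 \<le> n" and a: "0 < a" and x: "x \<in> student_cone n a" and u: "0 \<le> u"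
  shows "\<bar>(\<Sum>i=1..n. ln (f (x i - u))) - (\<Sum>i=1..n. ln (f (x i))) + real n * u * h1 (avg n x)\<bar>
    \<le> real n * u * (B2 / 2 * u + B3 / 2 * ((avg n x)\<^sup>2 / a\<^sup>2))"
proof -
  let ?m = "avg n x"
  define r where "r = (\<lambda>i. ln (f (x i - u)) - (ln (f (x i)) + h1 (x i) * (x i - u - x i)))"
  define s where "s = (\<Sum>i=1..n. h1 (x i)) - real n * h1 ?m"
  have r: "\<bar>r i\<bar> \<le> B2 / 2 * u\<^sup>2" for i
    unfolding r_def using quadratic_taylor_bound[OF h1 h2 B2, where y = "x i - u" and m = "x i"] by simp
  have "\<bar>\<Sum>i=1..n. r i\<bar> \<le> (\<Sum>i=1..n. B2 / 2 * u\<^sup>2)"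
    using r by (intro order_trans[OF sum_abs] sum_mono) auto
  then have R: "\<bar>\<Sum>i=1..n. r i\<bar> \<le> real n * (B2 / 2 * u\<^sup>2)" by simp
  have "\<bar>s\<bar> \<le> B3 / 2 * (\<Sum>i=1..n. (x i - ?m)\<^sup>2)"
    using sum_taylor_bound[OF h2 h3 B3 n, of x 0] by (simp add: s_def)
  also have "\<dots> \<le> B3 / 2 * (real n * ?m\<^sup>2 / a\<^sup>2)"
    using cone_deviation_le[OF n a x] B3_nonneg by (intro mult_left_mono) auto
  finally have S: "u * \<bar>s\<bar> \<le> u * (B3 / 2 * (real n * ?m\<^sup>2 / a\<^sup>2))"
    using u by (rule mult_left_mono)
  have "(\<Sum>i=1..n. ln (f (x i - u))) = (\<Sum>i=1..n. r i + ln (f (x i)) - u * h1 (x i))"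
    by (simp add: r_def)
  also have "\<dots> = (\<Sum>i=1..n. r i) + (\<Sum>i=1..n. ln (f (x i))) - u * (\<Sum>i=1..n. h1 (x i))"
    by (simp add: sum.distrib sum_subtractf sum_distrib_left)
  finally have "(\<Sum>i=1..n. ln (f (x i - u))) - (\<Sum>i=1..n. ln (f (x i))) + real n * u * h1 ?m
    = (\<Sum>i=1..n. r i) - u * s"
    by (simp add: s_def algebra_simps)
  also have "\<bar>\<dots>\<bar> \<le> \<bar>\<Sum>i=1..n. r i\<bar> + u * \<bar>s\<bar>"
    using u by (metis abs_mult abs_of_nonneg abs_triangle_ineq4)
  also have "\<dots> \<le> real n * (B2 / 2 * u\<^sup>2) + u * (B3 / 2 * (real n * ?m\<^sup>2 / a\<^sup>2))"
    using R S by (rule add_mono)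
  finally show ?thesis by (simp add: power2_eq_square algebra_simps)
qed

text \<open>A substitute for \<open>f\<close> at large means, where the Taylor bound fails because the error
  \<open>m\<^sup>2 / a\<^sup>2\<close> is not small. Half of the exponent \<open>\<gamma>\<close> is given away to the observations far from the
  mean, and the factor \<open>2 powr (1 + \<gamma>)\<close> absorbs shifts by at most 1.\<close>

definition envelope :: "real \<Rightarrow> real" where
  "envelope z = C * 2 powr (1 + \<gamma>) * (1 + z / 2) powr - (1 + \<gamma> / 2)"

lemma envelope_measurable[measurable]: "envelope \<in> borel_measurable borel"
  unfolding envelope_def by measurable

lemma f_shift_le:
  assumes u: "0 \<le> u" "u \<le> 1"
  shows "f (x - u) \<le> C * 2 powr (1 + \<gamma>) * exp (- (1 + \<gamma>) * ln (1 + max x 0))"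
proof -
  have "(1 + max (x - u) 0) powr - (1 + \<gamma>) \<le> ((1 + max x 0) / 2) powr - (1 + \<gamma>)"
    using u \<gamma>_pos by (intro powr_mono2') (auto simp: max_def)
  also have "\<dots> = 2 powr (1 + \<gamma>) * (1 + max x 0) powr - (1 + \<gamma>)"
  proof -
    have "((1 + max x 0) / 2) powr - q = 2 powr q * (1 + max x 0) powr - q" for q :: real
      by (simp add: powr_divide powr_minus field_simps)
    then show ?thesis .
  qed
  also have "(1 + max x 0) powr - (1 + \<gamma>) = exp (- (1 + \<gamma>) * ln (1 + max x 0))"
    by (simp add: powr_def)
  finally have "C * (1 + max (x - u) 0) powr - (1 + \<gamma>) \<le> C * (2 powr (1 + \<gamma>) * exp (- (1 + \<gamma>) * ln (1 + max x 0)))"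
    using C_pos by (intro mult_left_mono) auto
  then show ?thesis
    using decay[of "x - u"] by (simp add: mult.assoc)
qed

lemma f_le_envelope: "0 \<le> z \<Longrightarrow> f z \<le> envelope z"
proof -
  assume z: "0 \<le> z"
  have "(1 + max z 0) powr - (1 + \<gamma>) \<le> (1 + z / 2) powr - (1 + \<gamma>)"
    using z \<gamma>_pos by (intro powr_mono2') auto
  also have "\<dots> \<le> (1 + z / 2) powr - (1 + \<gamma> / 2)"
    using z \<gamma>_pos by (intro powr_mono) auto
  also have "\<dots> \<le> 2 powr (1 + \<gamma>) * (1 + z / 2) powr - (1 + \<gamma> / 2)"
    using \<gamma>_pos mult_right_mono[of 1 "2 powr (1 + \<gamma>)" "(1 + z / 2) powr - (1 + \<gamma> / 2)"]
    by (simp add: ge_one_powr_ge_zero)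
  finally have "C * (1 + max z 0) powr - (1 + \<gamma>) \<le> C * (2 powr (1 + \<gamma>) * (1 + z / 2) powr - (1 + \<gamma> / 2))"
    using C_pos by (intro mult_left_mono) auto
  then show ?thesis
    using decay[of z] by (simp add: envelope_def mult.assoc)
qed

text \<open>In the cone, by Chebyshev's inequality, at most a fraction \<open>4 / a\<^sup>2\<close> of the observations lies below
  \<open>m / 2\<close>; the others each contribute the tail bound of \<open>f\<close> at \<open>m / 2\<close>.\<close>

lemma prod_f_le_envelope:
  assumes n: "1 \<le> n" and a: "0 < a" and x: "x \<in> student_cone n a" and u: "0 \<le> u" "u \<le> 1"
    and large: "(1 + \<gamma>) * (1 - 4 / a\<^sup>2) \<ge> 1 + \<gamma> / 2"
  shows "(\<Prod>i=1..n. f (x i - u)) \<le> envelope (avg n x) ^ n"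
proof -
  let ?m = "avg n x" and ?K = "C * 2 powr (1 + \<gamma>)"
  have m: "0 \<le> ?m" by (rule cone_avg_nonneg[OF a x])
  define l where "l = ln (1 + ?m / 2)"
  have l: "0 \<le> l" using m by (simp add: l_def)
  \<comment> \<open>Chebyshev pointwise: the left-hand side is at most 0 for observations below \<open>m / 2\<close>, and at most
    \<open>l\<close> otherwise. For \<open>m = 0\<close> it is 0 because \<open>l = 0\<close>.\<close>
  have pt: "l * (1 - 4 * (x i - ?m)\<^sup>2 / ?m\<^sup>2) \<le> ln (1 + max (x i) 0)" for i
  proof (cases "?m / 2 \<le> x i")
    case True
    have "l * (1 - 4 * (x i - ?m)\<^sup>2 / ?m\<^sup>2) \<le> l * 1"
      using l by (intro mult_left_mono) auto
    also have "l \<le> ln (1 + max (x i) 0)"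
      unfolding l_def using True m by (subst ln_le_cancel_iff) auto
    finally show ?thesis by simp
  next
    case False
    then have "(?m / 2)\<^sup>2 \<le> (?m - x i)\<^sup>2"
      using m by (intro power_mono) auto
    then have "(?m / 2)\<^sup>2 \<le> (x i - ?m)\<^sup>2"
      by (simp only: power2_commute)
    then have "?m\<^sup>2 \<le> 4 * (x i - ?m)\<^sup>2" by (simp add: power_divide)
    then have "l * (1 - 4 * (x i - ?m)\<^sup>2 / ?m\<^sup>2) \<le> 0"
      using l m by (cases "?m = 0") (auto simp: l_def mult_le_0_iff le_divide_eq)
    also have "0 \<le> ln (1 + max (x i) 0)" by simp
    finally show ?thesis .
  qed
  have "real n * (l * (1 - 4 / a\<^sup>2)) \<le> l * (real n - 4 * (\<Sum>i=1..n. (x i - ?m)\<^sup>2) / ?m\<^sup>2)"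
  proof (cases "?m = 0")
    case False
    have "(\<Sum>i=1..n. (x i - ?m)\<^sup>2) / ?m\<^sup>2 \<le> real n * ?m\<^sup>2 / a\<^sup>2 / ?m\<^sup>2"
      using cone_deviation_le[OF n a x] by (intro divide_right_mono) auto
    also have "\<dots> = real n / a\<^sup>2" using False by simp
    finally have "l * (real n - 4 * (real n / a\<^sup>2)) \<le> l * (real n - 4 * ((\<Sum>i=1..n. (x i - ?m)\<^sup>2) / ?m\<^sup>2))"
      using l by (intro mult_left_mono) auto
    then show ?thesis by (simp add: algebra_simps)
  qed (simp add: l_def)
  also have "\<dots> = (\<Sum>i=1..n. l * (1 - 4 * (x i - ?m)\<^sup>2 / ?m\<^sup>2))"
    by (simp add: sum_subtractf sum_distrib_left right_diff_distrib sum_divide_distrib mult.commute mult.left_commute)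
  also have "\<dots> \<le> (\<Sum>i=1..n. ln (1 + max (x i) 0))"
    by (intro sum_mono pt)
  finally have S: "real n * (l * (1 - 4 / a\<^sup>2)) \<le> (\<Sum>i=1..n. ln (1 + max (x i) 0))" .
  have "(\<Prod>i=1..n. f (x i - u)) \<le> (\<Prod>i=1..n. ?K * exp (- (1 + \<gamma>) * ln (1 + max (x i) 0)))"
    using f_pos f_shift_le[OF u] by (intro prod_mono) (auto intro: less_imp_le)
  also have "\<dots> = ?K ^ n * exp (- (1 + \<gamma>) * (\<Sum>i=1..n. ln (1 + max (x i) 0)))"
    unfolding prod.distrib sum_distrib_left by (simp add: exp_sum power_mult_distrib)
  also have "\<dots> \<le> ?K ^ n * exp (real n * (- (1 + \<gamma> / 2) * l))"
  proof -
    have "real n * ((1 + \<gamma> / 2) * l) \<le> real n * ((1 + \<gamma>) * (1 - 4 / a\<^sup>2) * l)"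
      using large l by (intro mult_left_mono mult_right_mono) auto
    also have "\<dots> = (1 + \<gamma>) * (real n * (l * (1 - 4 / a\<^sup>2)))" by simp
    also have "\<dots> \<le> (1 + \<gamma>) * (\<Sum>i=1..n. ln (1 + max (x i) 0))"
      using S \<gamma>_pos by (intro mult_left_mono) auto
    finally have "- (1 + \<gamma>) * (\<Sum>i=1..n. ln (1 + max (x i) 0)) \<le> real n * (- (1 + \<gamma> / 2) * l)"
      by (simp add: algebra_simps)
    then show ?thesis using C_pos by (intro mult_left_mono) auto
  qed
  also have "\<dots> = envelope ?m ^ n"
    using m by (simp add: envelope_def power_mult_distrib powr_def l_def exp_of_nat_mult)
  finally show ?thesis .
qed

lemma envelope_scale_tendsto: "((\<lambda>z. (1 + z / 2) powr - (\<gamma> / 2)) \<longlongrightarrow> 0) at_top"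
proof (rule tendsto_neg_powr)
  show "filterlim (\<lambda>z::real. 1 + z / 2) at_top at_top"
    unfolding filterlim_at_top eventually_at_top_linorder
    by (intro allI) (rule_tac x = "2 * Z" in exI, auto)
qed (use \<gamma>_pos in auto)

lemma nn_integral_envelope_finite: "(\<integral>\<^sup>+z. ennreal (envelope z) * indicator {0..} z \<partial>lborel) < \<infinity>"
proof -
  let ?K = "C * 2 powr (1 + \<gamma>)"
  let ?F = "\<lambda>z. - (4 / \<gamma>) * ?K * (1 + z / 2) powr - (\<gamma> / 2)"
  have "(\<integral>\<^sup>+z. ennreal (envelope z) * indicator {0..} z \<partial>lborel) = ennreal (0 - ?F 0)"
  proof (rule nn_integral_FTC_atLeast)
    fix z :: real assume z: "0 \<le> z"
    show "DERIV ?F z :> envelope z"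
    proof -
      have "((\<lambda>z. 1 + z / 2) has_real_derivative 1 / 2) (at z)"
        by (auto intro!: derivative_eq_intros)
      then have "((\<lambda>z. (1 + z / 2) powr - (\<gamma> / 2)) has_real_derivative
          - (\<gamma> / 2) * (1 + z / 2) powr (- (\<gamma> / 2) - of_nat 1) * (1 / 2)) (at z)"
        using z by (intro DERIV_fun_powr) auto
      then have "DERIV ?F z :> - (4 / \<gamma>) * ?K * (- (\<gamma> / 2) * (1 + z / 2) powr (- (\<gamma> / 2) - of_nat 1) * (1 / 2))"
        by (rule DERIV_cmult)
      also have "- (4 / \<gamma>) * ?K * (- (\<gamma> / 2) * (1 + z / 2) powr (- (\<gamma> / 2) - of_nat 1) * (1 / 2)) = envelope z"
      proof -
        have "- (\<gamma> / 2) - of_nat 1 = - (1 + \<gamma> / 2)" by simp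
        then show ?thesis using \<gamma>_pos by (simp only: envelope_def) simp
      qed
      finally show ?thesis .
    qed
    show "0 \<le> envelope z" using C_pos by (simp add: envelope_def)
  next
    show "(?F \<longlongrightarrow> 0) at_top"
      by (rule tendsto_mult_right_zero[OF envelope_scale_tendsto])
  qed measurable
  then show ?thesis by simp
qed

lemma envelope_tail:
  assumes "0 < e"
  obtains K where "0 < K" "\<And>z. K \<le> z \<Longrightarrow> z * envelope z \<le> e"
proof -
  let ?K = "C * 2 powr (1 + \<gamma>)"
  have "((\<lambda>z. 2 * ?K * (1 + z / 2) powr - (\<gamma> / 2)) \<longlongrightarrow> 0) at_top"
    by (rule tendsto_mult_right_zero[OF envelope_scale_tendsto])
  then have "\<forall>\<^sub>F z in at_top. 2 * ?K * (1 + z / 2) powr - (\<gamma> / 2) < e"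
    using assms by (rule order_tendstoD)
  then obtain K where K: "\<And>z. K \<le> z \<Longrightarrow> 2 * ?K * (1 + z / 2) powr - (\<gamma> / 2) < e"
    by (auto simp: eventually_at_top_linorder)
  have "z * envelope z \<le> e" if "max K 1 \<le> z" for z
  proof -
    have "z * envelope z = ?K * (z * ((1 + z / 2) powr - 1 * (1 + z / 2) powr - (\<gamma> / 2)))"
      unfolding powr_add[symmetric] by (simp add: envelope_def)
    also have "\<dots> \<le> ?K * (2 * (1 + z / 2) powr - (\<gamma> / 2))"
    proof (intro mult_left_mono)
      have "z * (1 + z / 2) powr - 1 \<le> 2"
        using that by (simp add: powr_minus field_simps)
      then have "z * (1 + z / 2) powr - 1 * (1 + z / 2) powr - (\<gamma> / 2) \<le> 2 * (1 + z / 2) powr - (\<gamma> / 2)"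
        by (intro mult_right_mono) auto
      then show "z * ((1 + z / 2) powr - 1 * (1 + z / 2) powr - (\<gamma> / 2)) \<le> 2 * (1 + z / 2) powr - (\<gamma> / 2)"
        by (simp add: mult.assoc)
    qed (use C_pos in auto)
    also have "\<dots> \<le> e" using K[of z] that by simp
    finally show ?thesis .
  qed
  then show ?thesis using that[of "max K 1"] by auto
qed

text \<open>Strict maximality becomes a uniform gap by compactness; large \<open>z\<close> is left to the envelope.\<close>

lemma off_maximizer_gap:
  assumes "0 < e"
  obtains q where "0 < q" "q < z0 * f z0" "\<And>z. 0 \<le> z \<Longrightarrow> z \<le> K \<Longrightarrow> e \<le> \<bar>z - z0\<bar> \<Longrightarrow> z * f z \<le> q"
proof -
  let ?M = "z0 * f z0"
  have M: "0 < ?M" using z0_pos f_pos by simp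
  define S where "S = {0..K} - ball z0 e"
  have S: "compact S" unfolding S_def by (intro compact_diff) auto
  have "\<exists>q < ?M. \<forall>z\<in>S. z * f z \<le> q"
  proof (cases "S = {}")
    case True then show ?thesis using M by blast
  next
    case False
    then obtain y where y: "y \<in> S" "\<And>z. z \<in> S \<Longrightarrow> z * f z \<le> y * f y"
      using continuous_attains_sup[OF S False, of "\<lambda>z. z * f z"] continuous_on_mult[OF continuous_on_id f_continuous]
      by blast
    have "y \<noteq> z0" using y(1) assms by (auto simp: S_def)
    then show ?thesis using y maximizer by blast
  qed
  then obtain q where q: "q < ?M" "\<And>z. z \<in> S \<Longrightarrow> z * f z \<le> q" by blast
  show ?thesis
  proof (rule that[of "max q (?M / 2)"])
    fix z assume "0 \<le> z" "z \<le> K" "e \<le> \<bar>z - z0\<bar>"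
    then have "z \<in> S" by (auto simp: S_def dist_real_def)
    then show "z * f z \<le> max q (?M / 2)" using q(2) by fastforce
  qed (use q M in auto)
qed

section \<open>Concentration of the sample mean and the limit of the probability ratio\<close>

text \<open>For i.i.d. \<open>X i\<close> with density \<open>f\<close>, the probability that the sample \<open>X i + u\<close> lies in the cone and has
  its mean in \<open>S\<close>. Extended nonnegative values postpone all finiteness questions to the end.\<close>

definition cone_mass :: "nat \<Rightarrow> real \<Rightarrow> real \<Rightarrow> real set \<Rightarrow> ennreal" where
  "cone_mass n a u S = (\<integral>\<^sup>+x. ennreal (\<Prod>i=1..n. f (x i - u)) * indicator S (avg n x) * indicator (student_cone n a) x \<partial>lebesgue_prod n)"

lemma cone_mass_split:
  assumes S[measurable]: "S \<in> sets borel"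
  shows "cone_mass n a u UNIV = cone_mass n a u S + cone_mass n a u (- S)"
proof -
  have "cone_mass n a u S + cone_mass n a u (- S) = (\<integral>\<^sup>+x.
    ennreal (\<Prod>i=1..n. f (x i - u)) * indicator S (avg n x) * indicator (student_cone n a) x +
    ennreal (\<Prod>i=1..n. f (x i - u)) * indicator (- S) (avg n x) * indicator (student_cone n a) x \<partial>lebesgue_prod n)"
    unfolding cone_mass_def by (rule nn_integral_add[symmetric]) measurable
  also have "\<dots> = cone_mass n a u UNIV"
    unfolding cone_mass_def by (intro nn_integral_cong) (auto simp: indicator_def)
  finally show ?thesis ..
qed

lemma h1_lipschitz: "\<bar>h1 y - h1 x\<bar> \<le> B2 * \<bar>y - x\<bar>"
  using field_differentiable_bound[of UNIV h1 h2 B2 y x] h2 B2 by auto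

text \<open>On the cone the joint density is at most \<open>(r * \<phi> m) ^ n\<close>, where \<open>\<phi>\<close> is \<open>f\<close> up to a large \<open>K\<close> and the
  envelope beyond it, and \<open>r > 1\<close> is as close to 1 as desired. After integrating out everything but
  the mean, the integrand is a power of \<open>z * \<phi> z\<close>, which off a ball around \<open>z0\<close> stays below its
  maximum. One factor \<open>\<phi> z\<close> is kept aside to make the integral over the half-line finite.\<close>

lemma cone_mass_far_upper:
  assumes a: "filterlim a at_top sequentially" and e: "0 < e" and t: "0 \<le> t"
  obtains q D where "0 < q" "q < z0 * f z0" "0 \<le> D"
    "\<forall>\<^sub>F n in sequentially. cone_mass n (a n) (t / n) (- ball z0 e) \<le> ennreal (D * (real n * cone_volume n (a n) * q ^ n))"
proof -
  let ?M = "z0 * f z0"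
  have M: "0 < ?M" using z0_pos f_pos by simp
  obtain K where K: "0 < K" "\<And>z. K \<le> z \<Longrightarrow> z * envelope z \<le> ?M / 2"
    using envelope_tail[of "?M / 2"] M by auto
  obtain q0 where q0: "0 < q0" "q0 < ?M" "\<And>z. 0 \<le> z \<Longrightarrow> z \<le> K \<Longrightarrow> e \<le> \<bar>z - z0\<bar> \<Longrightarrow> z * f z \<le> q0"
    using off_maximizer_gap[OF e, of K] by metis
  \<comment> \<open>\<open>p\<close> bounds \<open>z * \<phi> z\<close> off the ball, and the slack between \<open>p\<close> and \<open>q\<close> pays for the factor
    \<open>r = q / p\<close>.\<close>
  define p where "p = max q0 (?M / 2)"
  define q where "q = (p + ?M) / 2"
  have p: "0 < p" "p < ?M" using q0 M by (auto simp: p_def)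
  have q: "0 < q" "q < ?M" "p < q" using p M by (auto simp: q_def)
  define r where "r = q / p"
  have r: "1 < r" "r * p = q" using p q by (auto simp: r_def)
  define \<phi> where "\<phi> = (\<lambda>z. if z \<le> K then f z else envelope z)"
  have [measurable]: "\<phi> \<in> borel_measurable borel" unfolding \<phi>_def by measurable
  have \<phi>: "0 \<le> \<phi> z" "0 \<le> z \<Longrightarrow> \<phi> z \<le> envelope z" for z
    using f_pos[of z] C_pos f_le_envelope[of z] by (auto simp: \<phi>_def envelope_def)
  have z\<phi>: "z * \<phi> z \<le> p" if "0 \<le> z" "z \<notin> ball z0 e" for z
    using that q0(3)[of z] K(2)[of z] by (auto simp: \<phi>_def p_def dist_real_def abs_minus_commute)
  define E where "E = enn2real (\<integral>\<^sup>+z. ennreal (envelope z) * indicator {0..} z \<partial>lborel)"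
  have E: "(\<integral>\<^sup>+z. ennreal (envelope z) * indicator {0..} z \<partial>lborel) = ennreal E" "0 \<le> E"
    using nn_integral_envelope_finite by (auto simp: E_def)
  define H where "H = \<bar>h1 z0\<bar> + B2 * (K + z0)"
  define b where "b = (\<lambda>n. t / real n * H + B2 / 2 * (K\<^sup>2 / (a n)\<^sup>2 + (t / real n)\<^sup>2))"
  have u0: "(\<lambda>n. t / real n) \<longlonglongrightarrow> 0"
    by (intro tendsto_divide_0[OF tendsto_const] filterlim_at_top_imp_at_infinity filterlim_real_sequentially)
  have a0: "(\<lambda>n. k / (a n)\<^sup>2) \<longlonglongrightarrow> 0" for k
    by (intro tendsto_divide_0[OF tendsto_const] filterlim_at_top_imp_at_infinity filterlim_pow_at_top a) auto
  have "b \<longlonglongrightarrow> 0 * H + B2 / 2 * (0 + 0\<^sup>2)"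
    unfolding b_def by (intro tendsto_intros u0 a0)
  then have b0: "b \<longlonglongrightarrow> 0" by simp
  have "(\<lambda>n. (1 + \<gamma>) * (1 - 4 / (a n)\<^sup>2)) \<longlonglongrightarrow> (1 + \<gamma>) * (1 - 0)"
    by (intro tendsto_intros a0)
  moreover have "1 + \<gamma> / 2 < (1 + \<gamma>) * (1 - 0)" using \<gamma>_pos by simp
  ultimately have "\<forall>\<^sub>F n in sequentially. 1 + \<gamma> / 2 < (1 + \<gamma>) * (1 - 4 / (a n)\<^sup>2)"
    by (rule order_tendstoD)
  moreover have "\<forall>\<^sub>F n in sequentially. b n < ln r"
    using r by (intro order_tendstoD(2)[OF b0]) auto
  moreover have "\<forall>\<^sub>F n in sequentially. t / real n < 1"
    using order_tendstoD(2)[OF u0] by simp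
  moreover have "\<forall>\<^sub>F n in sequentially. 0 < a n"
    using a by (simp add: filterlim_at_top_dense)
  moreover have "\<forall>\<^sub>F n in sequentially. 1 \<le> n"
    by (rule eventually_ge_at_top)
  ultimately have "\<forall>\<^sub>F n in sequentially. cone_mass n (a n) (t / n) (- ball z0 e) \<le> ennreal (E / p * (real n * cone_volume n (a n) * q ^ n))"
  proof eventually_elim
    case (elim n)
    then have n: "1 \<le> n" and an: "0 < a n" by auto
    let ?w = "cone_volume n (a n)" and ?u = "t / real n"
    have u: "0 \<le> ?u" "?u \<le> 1" using t elim by auto
    have w: "0 < ?w" by (rule emeasure_cone_avg_less_1[OF n an])
    have prod_le: "(\<Prod>i=1..n. f (x i - ?u)) \<le> (r * \<phi> (avg n x)) ^ n" if x: "x \<in> student_cone n (a n)" for x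
    proof (cases "avg n x \<le> K")
      case False
      have "(\<Prod>i=1..n. f (x i - ?u)) \<le> envelope (avg n x) ^ n"
        using elim by (intro prod_f_le_envelope[OF n an x u]) auto
      also have "\<dots> = \<phi> (avg n x) ^ n" using False by (simp add: \<phi>_def)
      also have "\<dots> \<le> (r * \<phi> (avg n x)) ^ n"
        using r \<phi>(1)[of "avg n x"] mult_right_mono[of 1 r "\<phi> (avg n x)"] by (intro power_mono) auto
      finally show ?thesis .
    next
      case True
      let ?m = "avg n x"
      have m: "0 \<le> ?m" by (rule cone_avg_nonneg[OF an x])
      have "- h1 ?m \<le> \<bar>h1 z0\<bar> + B2 * \<bar>?m - z0\<bar>"
        using h1_lipschitz[of ?m z0] by (auto simp: abs_le_iff)
      also have "\<dots> \<le> H"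
        unfolding H_def using m True z0_pos B2_nonneg by (intro add_mono mult_left_mono) auto
      finally have H: "?u * (- h1 ?m) \<le> ?u * H" using u by (intro mult_left_mono)
      have "?m\<^sup>2 / (a n)\<^sup>2 \<le> K\<^sup>2 / (a n)\<^sup>2"
        using m True by (intro divide_right_mono power_mono) auto
      then have "B2 / 2 * (?m\<^sup>2 / (a n)\<^sup>2 + ?u\<^sup>2) \<le> B2 / 2 * (K\<^sup>2 / (a n)\<^sup>2 + ?u\<^sup>2)"
        using B2_nonneg by (intro mult_left_mono) auto
      moreover have "?u * H + B2 / 2 * (K\<^sup>2 / (a n)\<^sup>2 + ?u\<^sup>2) < ln r"
        using elim(2) by (simp only: b_def)
      moreover have "- ?u * h1 ?m = ?u * (- h1 ?m)" by simp
      ultimately have br: "- ?u * h1 ?m + B2 / 2 * (?m\<^sup>2 / (a n)\<^sup>2 + ?u\<^sup>2) \<le> ln r"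
        using H by linarith
      have "(\<Sum>i=1..n. ln (f (x i - ?u))) \<le> real n * (ln (f ?m) - ?u * h1 ?m) + real n * (B2 / 2 * (?m\<^sup>2 / (a n)\<^sup>2 + ?u\<^sup>2))"
        using prod_f_near_diagonal[OF n an x, of ?u] by linarith
      also have "\<dots> = real n * (ln (f ?m) + (- ?u * h1 ?m + B2 / 2 * (?m\<^sup>2 / (a n)\<^sup>2 + ?u\<^sup>2)))"
        by (simp only: distrib_left) (simp add: algebra_simps)
      also have "\<dots> \<le> real n * (ln (f ?m) + ln r)"
        using br by (intro mult_left_mono) auto
      finally have "(\<Prod>i=1..n. f (x i - ?u)) \<le> exp (real n * (ln (f ?m) + ln r))"
        by (simp add: prod_f_eq_exp)
      also have "\<dots> = (r * \<phi> ?m) ^ n"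
        using True f_pos r by (simp add: exp_of_nat_mult exp_add \<phi>_def mult.commute)
      finally show ?thesis .
    qed
    have "cone_mass n (a n) ?u (- ball z0 e) \<le> (\<integral>\<^sup>+x. (ennreal ((r * \<phi> (avg n x)) ^ n) * indicator (- ball z0 e) (avg n x)) * indicator (student_cone n (a n)) x \<partial>lebesgue_prod n)"
      unfolding cone_mass_def using prod_le
      by (intro nn_integral_mono) (auto simp: indicator_def intro!: ennreal_leI)
    also have "\<dots> = (\<integral>\<^sup>+z. (ennreal ((r * \<phi> z) ^ n) * indicator (- ball z0 e) z) * (ennreal (real n * ?w * z ^ (n - 1)) * indicator {0..} z) \<partial>lborel)"
      by (rule nn_integral_cone[OF n an]) measurable
    also have "\<dots> \<le> (\<integral>\<^sup>+z. ennreal (real n * ?w * r ^ n * p ^ (n - 1)) * (ennreal (envelope z) * indicator {0..} z) \<partial>lborel)"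
    proof (intro nn_integral_mono)
      fix z :: real
      show "(ennreal ((r * \<phi> z) ^ n) * indicator (- ball z0 e) z) * (ennreal (real n * ?w * z ^ (n - 1)) * indicator {0..} z)
        \<le> ennreal (real n * ?w * r ^ n * p ^ (n - 1)) * (ennreal (envelope z) * indicator {0..} z)"
      proof (cases "0 \<le> z \<and> z \<notin> ball z0 e")
        case True
        then have z: "0 \<le> z" by simp
        have "(r * \<phi> z) ^ n * (real n * ?w * z ^ (n - 1)) = real n * ?w * r ^ n * ((z * \<phi> z) ^ (n - 1) * \<phi> z)"
          using n by (cases n) (auto simp: power_mult_distrib)
        also have "\<dots> \<le> real n * ?w * r ^ n * (p ^ (n - 1) * envelope z)"
          using w r z \<phi>[of z] z\<phi>[of z] True p
          by (intro mult_left_mono mult_mono power_mono) auto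
        finally have "(r * \<phi> z) ^ n * (real n * ?w * z ^ (n - 1)) \<le> real n * ?w * r ^ n * p ^ (n - 1) * envelope z"
          by (simp add: mult.assoc)
        then have "ennreal ((r * \<phi> z) ^ n * (real n * ?w * z ^ (n - 1))) \<le> ennreal (real n * ?w * r ^ n * p ^ (n - 1) * envelope z)"
          by (rule ennreal_leI)
        moreover have "0 \<le> envelope z" "0 \<le> r * \<phi> z" using \<phi>[of z] z r by auto
        ultimately show ?thesis
          using True w r p by (simp add: ennreal_mult)
      qed (auto simp: indicator_def)
    qed
    also have "\<dots> = ennreal (real n * ?w * r ^ n * p ^ (n - 1)) * ennreal E"
      unfolding E(1)[symmetric] by (rule nn_integral_cmult) measurable
    also have "\<dots> = ennreal (real n * ?w * r ^ n * p ^ (n - 1) * E)"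
      using w r p E by (simp add: ennreal_mult)
    also have "real n * ?w * r ^ n * p ^ (n - 1) * E = E / p * (real n * ?w * q ^ n)"
      using n p unfolding r(2)[symmetric] by (cases n) (auto simp: power_mult_distrib)
    finally show ?case .
  qed
  then show ?thesis using that[of q "E / p"] q E p by auto
qed

text \<open>The matching lower bound: restricting the mean to a small interval on which \<open>z * f z\<close> exceeds a
  value between \<open>q\<close> and the maximum, the integral is at least of order \<open>n * q ^ n\<close> times the cone volume.\<close>

lemma cone_mass_near_lower:
  assumes a: "filterlim a at_top sequentially" and e: "0 < e" and q: "0 < q" "q < z0 * f z0"
  obtains D where "0 < D"
    "\<forall>\<^sub>F n in sequentially. ennreal (D * (real n * cone_volume n (a n) * q ^ n)) \<le> cone_mass n (a n) 0 (ball z0 e)"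
proof -
  let ?M = "z0 * f z0"
  define p where "p = (q + ?M) / 2"
  have p: "0 < p" "p < ?M" "q < p" using q by (auto simp: p_def)
  have "isCont (\<lambda>z. z * f z) z0"
    using continuous_on_mult[OF continuous_on_id f_continuous[of UNIV]]
    by (simp add: continuous_on_eq_continuous_at)
  then have "\<forall>\<^sub>F z in at z0. p < z * f z"
    using p(2) by (auto simp: isCont_def intro: order_tendstoD)
  then obtain d0 where d0: "0 < d0" "\<And>z. z \<noteq> z0 \<Longrightarrow> \<bar>z - z0\<bar> < d0 \<Longrightarrow> p < z * f z"
    by (auto simp: eventually_at dist_real_def)
  define d where "d = min d0 (min e z0) / 2"
  have d: "0 < d" "d < d0" "d < e" "d < z0" using d0 e z0_pos by (auto simp: d_def)
  have pd: "p < z * f z" if "z \<in> {z0 - d..z0 + d}" for z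
    using that d d0(2)[of z] p(2) by (cases "z = z0") auto
  have a0: "(\<lambda>n. k / (a n)\<^sup>2) \<longlonglongrightarrow> 0" for k
    by (intro tendsto_divide_0[OF tendsto_const] filterlim_at_top_imp_at_infinity filterlim_pow_at_top a) auto
  have "(\<lambda>n. B2 / 2 * ((z0 + d)\<^sup>2 / (a n)\<^sup>2)) \<longlonglongrightarrow> B2 / 2 * 0"
    by (intro tendsto_intros a0)
  moreover have "B2 / 2 * 0 < ln (p / q)" using p q by simp
  ultimately have "\<forall>\<^sub>F n in sequentially. B2 / 2 * ((z0 + d)\<^sup>2 / (a n)\<^sup>2) < ln (p / q)"
    by (rule order_tendstoD)
  moreover have "\<forall>\<^sub>F n in sequentially. 0 < a n"
    using a by (simp add: filterlim_at_top_dense)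
  moreover have "\<forall>\<^sub>F n in sequentially. 1 \<le> n"
    by (rule eventually_ge_at_top)
  ultimately have "\<forall>\<^sub>F n in sequentially. ennreal (2 * d / (z0 + d) * (real n * cone_volume n (a n) * q ^ n)) \<le> cone_mass n (a n) 0 (ball z0 e)"
  proof eventually_elim
    case (elim n)
    then have n: "1 \<le> n" and an: "0 < a n" by auto
    let ?w = "cone_volume n (a n)" and ?I = "{z0 - d..z0 + d}"
    have w: "0 < ?w" by (rule emeasure_cone_avg_less_1[OF n an])
    have prod_ge: "(q / p * f (avg n x)) ^ n \<le> (\<Prod>i=1..n. f (x i - 0))"
      if x: "x \<in> student_cone n (a n)" and I: "avg n x \<in> ?I" for x
    proof -
      let ?m = "avg n x"
      have m: "0 \<le> ?m" by (rule cone_avg_nonneg[OF an x])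
      have "?m\<^sup>2 / (a n)\<^sup>2 \<le> (z0 + d)\<^sup>2 / (a n)\<^sup>2"
        using m I by (intro divide_right_mono power_mono) auto
      then have "B2 / 2 * (?m\<^sup>2 / (a n)\<^sup>2) \<le> B2 / 2 * ((z0 + d)\<^sup>2 / (a n)\<^sup>2)"
        using B2_nonneg by (intro mult_left_mono) auto
      then have br: "B2 / 2 * (?m\<^sup>2 / (a n)\<^sup>2) \<le> ln (p / q)" using elim(1) by linarith
      have "(q / p * f ?m) ^ n = exp (real n * (ln (f ?m) - ln (p / q)))"
        using p q f_pos by (simp add: exp_of_nat_mult exp_diff mult.commute divide_simps)
      also have "\<dots> \<le> exp (real n * (ln (f ?m) - B2 / 2 * (?m\<^sup>2 / (a n)\<^sup>2)))"
        using br by (simp add: mult_left_mono)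
      also have "\<dots> \<le> exp (\<Sum>i=1..n. ln (f (x i - 0)))"
        using prod_f_near_diagonal[OF n an x, of 0] by (simp add: right_diff_distrib)
      finally show ?thesis unfolding prod_f_eq_exp .
    qed
    have "ennreal (2 * d / (z0 + d) * (real n * ?w * q ^ n)) = ennreal (real n * ?w * q ^ n / (z0 + d)) * emeasure lborel ?I"
      using d z0_pos w q by (simp add: mult_ac flip: ennreal_mult)
    also have "\<dots> = (\<integral>\<^sup>+z. ennreal (real n * ?w * q ^ n / (z0 + d)) * indicator ?I z \<partial>lborel)"
      by (simp add: nn_integral_cmult_indicator)
    also have "\<dots> \<le> (\<integral>\<^sup>+z. (ennreal ((q / p * f z) ^ n) * indicator ?I z) * (ennreal (real n * ?w * z ^ (n - 1)) * indicator {0..} z) \<partial>lborel)"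
    proof (intro nn_integral_mono)
      fix z :: real
      show "ennreal (real n * ?w * q ^ n / (z0 + d)) * indicator ?I z
        \<le> (ennreal ((q / p * f z) ^ n) * indicator ?I z) * (ennreal (real n * ?w * z ^ (n - 1)) * indicator {0..} z)"
      proof (cases "z \<in> ?I")
        case True
        then have z: "0 < z" "z \<le> z0 + d" using d by auto
        have "q = q / p * p" using p by simp
        also have "\<dots> \<le> q / p * (z * f z)"
          using pd[OF True] p q by (intro mult_left_mono) auto
        finally have "q ^ n \<le> (q / p * (z * f z)) ^ n"
          using q by (intro power_mono) auto
        then have "real n * ?w * q ^ n / (z0 + d) \<le> real n * ?w * (q / p * (z * f z)) ^ n / z"
          using z w q by (intro frac_le mult_left_mono mult_nonneg_nonneg) (auto intro: order_trans[rotated])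
        also have "\<dots> = (q / p * f z) ^ n * (real n * ?w * z ^ (n - 1))"
        proof -
          have "(c * (z * y)) ^ n = (c * y) ^ n * z ^ (n - 1) * z" for c y :: real
            using n by (cases n) (auto simp: power_mult_distrib)
          from this[of "q / p" "f z"] show ?thesis using z by simp
        qed
        finally have "ennreal (real n * ?w * q ^ n / (z0 + d)) \<le> ennreal ((q / p * f z) ^ n * (real n * ?w * z ^ (n - 1)))"
          by (rule ennreal_leI)
        moreover have "0 \<le> q / p * f z" using q p f_pos[of z] by simp
        ultimately show ?thesis
          using True z w by (simp add: ennreal_mult)
      qed simp
    qed
    also have "\<dots> = (\<integral>\<^sup>+x. (ennreal ((q / p * f (avg n x)) ^ n) * indicator ?I (avg n x)) * indicator (student_cone n (a n)) x \<partial>lebesgue_prod n)"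
      by (rule nn_integral_cone[OF n an, symmetric]) measurable
    also have "\<dots> \<le> cone_mass n (a n) 0 (ball z0 e)"
      unfolding cone_mass_def
    proof (intro nn_integral_mono)
      fix x
      show "(ennreal ((q / p * f (avg n x)) ^ n) * indicator ?I (avg n x)) * indicator (student_cone n (a n)) x
        \<le> ennreal (\<Prod>i=1..n. f (x i - 0)) * indicator (ball z0 e) (avg n x) * indicator (student_cone n (a n)) x"
      proof (cases "x \<in> student_cone n (a n) \<and> avg n x \<in> ?I")
        case True
        then have "avg n x \<in> ball z0 e" using d by (auto simp: dist_real_def)
        then show ?thesis using True prod_ge[of x] by (simp add: ennreal_leI)
      qed auto
    qed
    finally show ?case .
  qed
  then show ?thesis using that[of "2 * d / (z0 + d)"] d z0_pos by auto
qed

text \<open>Laplace's method: the rates of the upper bound off the maximizer and of the lower bound near it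
  are separated by a value strictly between them, and the quotient decays geometrically.\<close>

lemma cone_mass_far_negligible:
  assumes a: "filterlim a at_top sequentially" and e: "0 < e" and t: "0 \<le> t" and \<eta>: "0 < \<eta>"
  shows "\<forall>\<^sub>F n in sequentially. cone_mass n (a n) (t / n) (- ball z0 e) \<le> ennreal \<eta> * cone_mass n (a n) 0 (ball z0 e)"
proof -
  obtain q1 D1 where 1: "0 < q1" "q1 < z0 * f z0" "0 \<le> D1"
    "\<forall>\<^sub>F n in sequentially. cone_mass n (a n) (t / n) (- ball z0 e) \<le> ennreal (D1 * (real n * cone_volume n (a n) * q1 ^ n))"
    using cone_mass_far_upper[OF a e t] by blast
  define q2 where "q2 = (q1 + z0 * f z0) / 2"
  have q2: "q1 < q2" "q2 < z0 * f z0" "0 < q2" using 1 by (auto simp: q2_def)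
  obtain D2 where 2: "0 < D2"
    "\<forall>\<^sub>F n in sequentially. ennreal (D2 * (real n * cone_volume n (a n) * q2 ^ n)) \<le> cone_mass n (a n) 0 (ball z0 e)"
    using cone_mass_near_lower[OF a e q2(3,2)] by blast
  have "(\<lambda>n. D1 * (q1 / q2) ^ n) \<longlonglongrightarrow> D1 * 0"
    using 1 q2 by (intro tendsto_intros LIMSEQ_power_zero) auto
  moreover have "D1 * 0 < \<eta> * D2" using \<eta> 2 by simp
  ultimately have "\<forall>\<^sub>F n in sequentially. D1 * (q1 / q2) ^ n < \<eta> * D2"
    by (rule order_tendstoD)
  moreover have "\<forall>\<^sub>F n in sequentially. 0 < a n"
    using a by (simp add: filterlim_at_top_dense)
  ultimately show ?thesis
    using 1(4) 2(2) eventually_ge_at_top[of "1::nat"]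
  proof eventually_elim
    case (elim n)
    let ?w = "real n * cone_volume n (a n)"
    have w: "0 \<le> ?w" using emeasure_cone_avg_less_1(2)[OF elim(5,2)] by simp
    have "D1 * q1 ^ n \<le> \<eta> * D2 * q2 ^ n"
      using elim(1) q2 by (simp add: power_divide field_simps)
    then have "?w * (D1 * q1 ^ n) \<le> ?w * (\<eta> * D2 * q2 ^ n)"
      using w by (rule mult_left_mono)
    then have "ennreal (D1 * (?w * q1 ^ n)) \<le> ennreal (\<eta> * (D2 * (?w * q2 ^ n)))"
      by (intro ennreal_leI) (simp add: mult_ac)
    also have "\<dots> = ennreal \<eta> * ennreal (D2 * (?w * q2 ^ n))"
      using \<eta> w 2 q2 by (intro ennreal_mult) auto
    also have "\<dots> \<le> ennreal \<eta> * cone_mass n (a n) 0 (ball z0 e)"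
      using elim(4) by (intro mult_left_mono) auto
    finally show ?case using elim(3) by simp
  qed
qed

lemma cone_mass_near_pos:
  assumes a: "filterlim a at_top sequentially" and e: "0 < e"
  shows "\<forall>\<^sub>F n in sequentially. 0 < cone_mass n (a n) 0 (ball z0 e)"
proof -
  have q: "0 < z0 * f z0 / 2" "z0 * f z0 / 2 < z0 * f z0" using z0_pos f_pos[of z0] by auto
  obtain D where D: "0 < D"
    "\<forall>\<^sub>F n in sequentially. ennreal (D * (real n * cone_volume n (a n) * (z0 * f z0 / 2) ^ n)) \<le> cone_mass n (a n) 0 (ball z0 e)"
    using cone_mass_near_lower[OF a e q] by blast
  have "\<forall>\<^sub>F n in sequentially. 0 < a n"
    using a by (simp add: filterlim_at_top_dense)
  then show ?thesis
    using D(2) eventually_ge_at_top[of "1::nat"]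
  proof eventually_elim
    case (elim n)
    have "0 < D * (real n * cone_volume n (a n) * (z0 * f z0 / 2) ^ n)"
      using emeasure_cone_avg_less_1(2)[OF elim(3,1)] elim(3) D(1) q by simp
    then show ?case using elim(2) by (metis ennreal_less_zero_iff order_less_le_trans)
  qed
qed

text \<open>Near the maximizer the log-ratio of shifted and unshifted density is \<open>- t * h1 m\<close> plus a vanishing
  error, and \<open>- h1 m\<close> is close to \<open>- h1 z0 = 1 / z0\<close>.\<close>

lemma cone_mass_near_shift:
  assumes a: "filterlim a at_top sequentially" and t: "0 \<le> t" and \<delta>: "0 < \<delta>"
  obtains e where "0 < e"
    "\<forall>\<^sub>F n in sequentially. cone_mass n (a n) (t / n) (ball z0 e) \<le> ennreal (exp (t / z0 + \<delta>)) * cone_mass n (a n) 0 (ball z0 e)"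
    "\<forall>\<^sub>F n in sequentially. ennreal (exp (t / z0 - \<delta>)) * cone_mass n (a n) 0 (ball z0 e) \<le> cone_mass n (a n) (t / n) (ball z0 e)"
proof -
  \<comment> \<open>Half of \<open>\<delta>\<close> is spent on the variation of the score over the ball, half on the Taylor errors.\<close>
  define e where "e = \<delta> / (2 * (t * B2 + 1))"
  have tB: "0 \<le> t * B2" using t B2_nonneg by simp
  have e: "0 < e" using \<delta> tB by (simp add: e_def)
  have te: "t * (B2 * e) \<le> \<delta> / 2"
    using tB \<delta> by (simp add: e_def field_simps)
  have u0: "(\<lambda>n. t / real n) \<longlonglongrightarrow> 0"
    by (intro tendsto_divide_0[OF tendsto_const] filterlim_at_top_imp_at_infinity filterlim_real_sequentially)
  have a0: "(\<lambda>n. k / (a n)\<^sup>2) \<longlonglongrightarrow> 0" for k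
    by (intro tendsto_divide_0[OF tendsto_const] filterlim_at_top_imp_at_infinity filterlim_pow_at_top a) auto
  have "(\<lambda>n. t * (B2 / 2 * (t / real n) + B3 / 2 * ((z0 + e)\<^sup>2 / (a n)\<^sup>2))) \<longlonglongrightarrow> t * (B2 / 2 * 0 + B3 / 2 * 0)"
    by (intro tendsto_intros u0 a0)
  moreover have "t * (B2 / 2 * 0 + B3 / 2 * 0) < \<delta> / 2" using \<delta> by simp
  ultimately have "\<forall>\<^sub>F n in sequentially. t * (B2 / 2 * (t / real n) + B3 / 2 * ((z0 + e)\<^sup>2 / (a n)\<^sup>2)) < \<delta> / 2"
    by (rule order_tendstoD)
  moreover have "\<forall>\<^sub>F n in sequentially. 0 < a n"
    using a by (simp add: filterlim_at_top_dense)
  ultimately have key: "\<forall>\<^sub>F n in sequentially. \<forall>x. x \<in> student_cone n (a n) \<longrightarrow> avg n x \<in> ball z0 e \<longrightarrow>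
      (\<Prod>i=1..n. f (x i - t / n)) \<le> exp (t / z0 + \<delta>) * (\<Prod>i=1..n. f (x i - 0)) \<and>
      exp (t / z0 - \<delta>) * (\<Prod>i=1..n. f (x i - 0)) \<le> (\<Prod>i=1..n. f (x i - t / n))"
    using eventually_ge_at_top[of "1::nat"]
  proof eventually_elim
    case (elim n)
    then have n: "1 \<le> n" and an: "0 < a n" by auto
    let ?u = "t / real n"
    have u: "0 \<le> ?u" "real n * ?u = t" using t n by auto
    show ?case
    proof (intro allI impI)
      fix x assume x: "x \<in> student_cone n (a n)" and b: "avg n x \<in> ball z0 e"
      let ?m = "avg n x"
      let ?D = "(\<Sum>i=1..n. ln (f (x i - ?u))) - (\<Sum>i=1..n. ln (f (x i - 0)))"
      have m: "0 \<le> ?m" "\<bar>?m - z0\<bar> \<le> e"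
        using cone_avg_nonneg[OF an x] b by (auto simp: dist_real_def)
      have "?m\<^sup>2 / (a n)\<^sup>2 \<le> (z0 + e)\<^sup>2 / (a n)\<^sup>2"
        using m by (intro divide_right_mono power_mono) auto
      then have "t * (B2 / 2 * ?u + B3 / 2 * (?m\<^sup>2 / (a n)\<^sup>2)) \<le> t * (B2 / 2 * ?u + B3 / 2 * ((z0 + e)\<^sup>2 / (a n)\<^sup>2))"
        using t B3_nonneg by (intro mult_left_mono add_left_mono) auto
      then have "\<bar>?D + t * h1 ?m\<bar> \<le> \<delta> / 2"
        using shift_log_ratio[OF n an x u(1)] elim(1) unfolding u(2) by simp
      moreover have "\<bar>t * h1 ?m + t / z0\<bar> \<le> \<delta> / 2"
      proof -
        have "\<bar>h1 ?m - h1 z0\<bar> \<le> B2 * e"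
          using h1_lipschitz[of ?m z0] m(2) B2_nonneg by (meson mult_left_mono order_trans)
        then have "t * \<bar>h1 ?m - h1 z0\<bar> \<le> \<delta> / 2"
          using te t by (meson mult_left_mono order_trans)
        moreover have "t * \<bar>h1 ?m - h1 z0\<bar> = \<bar>t * (h1 ?m - h1 z0)\<bar>" using t by (simp add: abs_mult)
        moreover have "t * (h1 ?m - h1 z0) = t * h1 ?m + t / z0" by (simp add: h1_maximizer algebra_simps)
        ultimately show ?thesis by simp
      qed
      ultimately have D: "t / z0 - \<delta> \<le> ?D" "?D \<le> t / z0 + \<delta>" by linarith+
      have "(\<Prod>i=1..n. f (x i - ?u)) = exp ?D * (\<Prod>i=1..n. f (x i - 0))"
        unfolding prod_f_eq_exp by (simp flip: exp_add)
      moreover have "0 \<le> (\<Prod>i=1..n. f (x i - 0))"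
        using f_pos by (intro prod_nonneg) (auto intro: less_imp_le)
      ultimately show "(\<Prod>i=1..n. f (x i - t / n)) \<le> exp (t / z0 + \<delta>) * (\<Prod>i=1..n. f (x i - 0)) \<and>
          exp (t / z0 - \<delta>) * (\<Prod>i=1..n. f (x i - 0)) \<le> (\<Prod>i=1..n. f (x i - t / n))"
        using D by (auto intro!: mult_right_mono)
    qed
  qed
  have P: "0 \<le> (\<Prod>i=1..n. f (x i - 0))" for n :: nat and x
    using f_pos by (intro prod_nonneg) (auto intro: less_imp_le)
  have cmult: "ennreal c * cone_mass n b 0 S = (\<integral>\<^sup>+x. ennreal (c * (\<Prod>i=1..n. f (x i - 0))) * indicator S (avg n x) * indicator (student_cone n b) x \<partial>lebesgue_prod n)"
    if [measurable]: "S \<in> sets borel" and c: "0 \<le> c" for n b c S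
    unfolding cone_mass_def using c P
    by (subst nn_integral_cmult[symmetric]) (simp_all add: ennreal_mult mult.assoc)
  show ?thesis
  proof (rule that[OF e])
    show "\<forall>\<^sub>F n in sequentially. cone_mass n (a n) (t / n) (ball z0 e) \<le> ennreal (exp (t / z0 + \<delta>)) * cone_mass n (a n) 0 (ball z0 e)"
      using key
    proof eventually_elim
      case (elim n)
      show ?case
        unfolding cmult[OF borel_open[OF open_ball] exp_ge_zero] unfolding cone_mass_def
        using elim by (intro nn_integral_mono) (auto simp: indicator_def intro!: ennreal_leI)
    qed
    show "\<forall>\<^sub>F n in sequentially. ennreal (exp (t / z0 - \<delta>)) * cone_mass n (a n) 0 (ball z0 e) \<le> cone_mass n (a n) (t / n) (ball z0 e)"
      using key
    proof eventually_elim
      case (elim n)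
      show ?case
        unfolding cmult[OF borel_open[OF open_ball] exp_ge_zero] unfolding cone_mass_def
        using elim by (intro nn_integral_mono) (auto simp: indicator_def intro!: ennreal_leI)
    qed
  qed
qed

text \<open>Both probabilities are their near parts up to a relative error \<open>\<delta>\<close>, and the near parts have the
  ratio \<open>exp (t / z0)\<close> up to a factor \<open>exp \<delta>\<close>.\<close>

lemma shifted_probability_ratio:
  assumes a: "filterlim a at_top sequentially" and t: "0 \<le> t"
    and P: "\<And>n u. 1 \<le> n \<Longrightarrow> cone_mass n (a n) u UNIV = ennreal (P n u)"
    and P_nonneg: "\<And>n u. 0 \<le> P n u"
  shows "(\<lambda>n. P n (t / n) / P n 0) \<longlonglongrightarrow> exp (t / z0)"
proof -
  let ?R = "\<lambda>n. P n (t / n) / P n 0"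
  let ?l = "\<lambda>\<delta>. exp (t / z0 - \<delta>) / (1 + \<delta>)" and ?u = "\<lambda>\<delta>. exp (t / z0 + \<delta>) + \<delta>"
  have sandwich: "\<forall>\<^sub>F n in sequentially. ?l \<delta> \<le> ?R n \<and> ?R n \<le> ?u \<delta>" if \<delta>: "0 < \<delta>" for \<delta>
  proof -
    obtain e where e: "0 < e"
      "\<forall>\<^sub>F n in sequentially. cone_mass n (a n) (t / n) (ball z0 e) \<le> ennreal (exp (t / z0 + \<delta>)) * cone_mass n (a n) 0 (ball z0 e)"
      "\<forall>\<^sub>F n in sequentially. ennreal (exp (t / z0 - \<delta>)) * cone_mass n (a n) 0 (ball z0 e) \<le> cone_mass n (a n) (t / n) (ball z0 e)"
      using cone_mass_near_shift[OF a t \<delta>] by blast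
    have far_t: "\<forall>\<^sub>F n in sequentially. cone_mass n (a n) (t / n) (- ball z0 e) \<le> ennreal \<delta> * cone_mass n (a n) 0 (ball z0 e)"
      by (rule cone_mass_far_negligible[OF a e(1) t \<delta>])
    have far_0: "\<forall>\<^sub>F n in sequentially. cone_mass n (a n) (0 / real n) (- ball z0 e) \<le> ennreal \<delta> * cone_mass n (a n) 0 (ball z0 e)"
      by (rule cone_mass_far_negligible[OF a e(1) order_refl \<delta>])
    show ?thesis
      using e(2,3) far_t far_0 cone_mass_near_pos[OF a e(1)] eventually_ge_at_top[of "1::nat"]
    proof eventually_elim
      case (elim n)
      let ?near = "\<lambda>u. cone_mass n (a n) u (ball z0 e)" and ?far = "\<lambda>u. cone_mass n (a n) u (- ball z0 e)"
      have split: "ennreal (P n u) = ?near u + ?far u" for u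
        unfolding P[OF elim(6), symmetric] by (rule cone_mass_split) simp
      have fin: "?near u = ennreal (enn2real (?near u))" "?far u = ennreal (enn2real (?far u))" for u
        using split[of u] by (auto intro!: ennreal_enn2real[symmetric] simp: less_top[symmetric])
      define N where "N = (\<lambda>u. enn2real (?near u))"
      define F where "F = (\<lambda>u. enn2real (?far u))"
      have N: "?near u = ennreal (N u)" "0 \<le> N u" and F: "?far u = ennreal (F u)" "0 \<le> F u" for u
        using fin by (auto simp: N_def F_def)
      have PNF: "P n u = N u + F u" for u
        using split[of u] N F P_nonneg[of n u] by (simp flip: ennreal_plus)
      have N0: "0 < N 0" using elim(5) N by simp
      have 1: "N (t / n) \<le> exp (t / z0 + \<delta>) * N 0"
        using elim(1) N by (simp flip: ennreal_mult)
      have 2: "exp (t / z0 - \<delta>) * N 0 \<le> N (t / n)"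
        using elim(2) N by (simp flip: ennreal_mult)
      have 3: "F (t / n) \<le> \<delta> * N 0"
        using elim(3) N F \<delta> by (simp flip: ennreal_mult)
      have 4: "F 0 \<le> \<delta> * N 0"
        using elim(4) N F \<delta> by (simp flip: ennreal_mult)
      have P0: "N 0 \<le> P n 0" "P n 0 \<le> (1 + \<delta>) * N 0"
        using 4 F(2)[of 0] by (auto simp: PNF distrib_right)
      have Pt: "exp (t / z0 - \<delta>) * N 0 \<le> P n (t / n)" "P n (t / n) \<le> ?u \<delta> * N 0"
        using 1 2 3 F(2)[of "t / n"] by (auto simp: PNF distrib_right)
      have "?l \<delta> = exp (t / z0 - \<delta>) * N 0 / ((1 + \<delta>) * N 0)" using N0 by simp
      also have "\<dots> \<le> ?R n" using P0 Pt N0 P_nonneg by (intro frac_le) auto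
      finally have "?l \<delta> \<le> ?R n" .
      moreover have "?R n \<le> ?u \<delta> * N 0 / N 0"
        using P0 Pt N0 P_nonneg[of n "t / n"] by (intro frac_le) auto
      ultimately show ?case using N0 by simp
    qed
  qed
  show ?thesis
  proof (rule order_tendstoI)
    fix l assume l: "l < exp (t / z0)"
    have "(?l \<longlongrightarrow> exp (t / z0 - 0) / (1 + 0)) (at_right 0)"
      by (intro tendsto_intros) auto
    then have "\<forall>\<^sub>F \<delta> in at_right 0. l < ?l \<delta>"
      by (rule order_tendstoD) (use l in simp)
    then have "\<forall>\<^sub>F \<delta> in at_right 0. 0 < \<delta> \<and> l < ?l \<delta>"
      using eventually_at_right_less[of "0::real"] by eventually_elim simp
    then obtain \<delta> where "0 < \<delta>" "l < ?l \<delta>"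
      using eventually_happens'[OF trivial_limit_at_right_real] by blast
    then show "\<forall>\<^sub>F n in sequentially. l < ?R n"
      using sandwich[of \<delta>] by (auto elim!: eventually_mono)
  next
    fix l assume l: "exp (t / z0) < l"
    have "(?u \<longlongrightarrow> exp (t / z0 + 0) + 0) (at_right 0)"
      by (intro tendsto_intros)
    then have "\<forall>\<^sub>F \<delta> in at_right 0. ?u \<delta> < l"
      by (rule order_tendstoD) (use l in simp)
    then have "\<forall>\<^sub>F \<delta> in at_right 0. 0 < \<delta> \<and> ?u \<delta> < l"
      using eventually_at_right_less[of "0::real"] by eventually_elim simp
    then obtain \<delta> where "0 < \<delta>" "?u \<delta> < l"
      using eventually_happens'[OF trivial_limit_at_right_real] by blast
    then show "\<forall>\<^sub>F n in sequentially. ?R n < l"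
      using sandwich[of \<delta>] by (auto elim!: eventually_mono)
  qed
qed

end

section \<open>From probabilities to integrals over the cone\<close>

text \<open>Boundedness of \<open>f\<close> extends the bound at infinity to the whole line.\<close>

lemma polynomial_tail_bound:
  fixes f :: "real \<Rightarrow> real"
  assumes bdd: "bounded (range f)" and pos: "\<And>x. 0 < f x" and \<gamma>: "0 < \<gamma>"
    and lim: "Limsup at_top (\<lambda>x. ereal (x powr (1 + \<gamma>) * f x)) < \<infinity>"
  obtains C where "\<And>x. f x \<le> C * (1 + max x 0) powr - (1 + \<gamma>)"
proof -
  obtain F where F: "\<And>x. f x \<le> F"
    using bdd by (auto simp: bounded_iff abs_le_iff)
  have F0: "0 < F" using pos[of 0] F[of 0] by linarith
  obtain m :: nat where "Limsup at_top (\<lambda>x. ereal (x powr (1 + \<gamma>) * f x)) < ereal (real m)"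
    using lim less_PInf_Ex_of_nat by auto
  then have "\<forall>\<^sub>F x in at_top. ereal (x powr (1 + \<gamma>) * f x) < ereal (real m)"
    by (rule Limsup_lessD)
  then obtain y where y: "\<And>x. y \<le> x \<Longrightarrow> x powr (1 + \<gamma>) * f x < real m"
    by (auto simp: eventually_at_top_linorder)
  define w where "w = max y 1"
  define C where "C = max (F * (1 + w) powr (1 + \<gamma>)) (2 powr (1 + \<gamma>) * real m)"
  have "f x \<le> C * (1 + max x 0) powr - (1 + \<gamma>)" for x
  proof -
    let ?v = "1 + max x 0"
    have v: "0 < ?v" by auto
    have "f x * ?v powr (1 + \<gamma>) \<le> C"
    proof (cases "w \<le> x")
      case True
      then have x: "y \<le> x" "1 \<le> x" by (auto simp: w_def)
      have "?v powr (1 + \<gamma>) \<le> (2 * x) powr (1 + \<gamma>)"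
        using x \<gamma> by (intro powr_mono2) auto
      then have "f x * ?v powr (1 + \<gamma>) \<le> f x * (2 * x) powr (1 + \<gamma>)"
        using pos[of x] by (intro mult_left_mono) auto
      also have "\<dots> = 2 powr (1 + \<gamma>) * (x powr (1 + \<gamma>) * f x)"
        using x by (simp add: powr_mult)
      also have "\<dots> \<le> 2 powr (1 + \<gamma>) * real m"
        using y[OF x(1)] by (intro mult_left_mono) auto
      finally show ?thesis by (simp add: C_def)
    next
      case False
      have "f x * ?v powr (1 + \<gamma>) \<le> F * (1 + w) powr (1 + \<gamma>)"
        using F[of x] F0 False \<gamma> by (intro mult_mono powr_mono2) (auto simp: w_def)
      then show ?thesis by (simp add: C_def)
    qed
    then show ?thesis
      using v by (simp only: powr_minus) (simp add: field_simps)
  qed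
  then show ?thesis by (rule that)
qed

lemma (in prob_space) emeasure_joint_density:
  fixes Y :: "'i \<Rightarrow> 'a \<Rightarrow> real" and g :: "real \<Rightarrow> real"
  assumes indep: "indep_vars (\<lambda>_. borel) Y I"
    and dist: "\<And>i. i \<in> I \<Longrightarrow> distributed M lborel (Y i) (\<lambda>x. ennreal (g x))"
    and I: "finite I" "I \<noteq> {}" and g: "\<And>x. 0 \<le> g x"
    and A: "A \<in> sets (Pi\<^sub>M I (\<lambda>_. lborel))"
  shows "emeasure M {\<omega> \<in> space M. (\<lambda>i\<in>I. Y i \<omega>) \<in> A} =
    (\<integral>\<^sup>+x. ennreal (\<Prod>i\<in>I. g (x i)) * indicator A x \<partial>Pi\<^sub>M I (\<lambda>_. lborel))"
proof -
  let ?L = "Pi\<^sub>M I (\<lambda>_. lborel :: real measure)"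
  have rv: "random_variable borel (Y i)" if "i \<in> I" for i
    using distributed_measurable[OF dist[OF that]] by simp
  have gm[measurable]: "(\<lambda>x. ennreal (g x)) \<in> borel_measurable borel"
    using I dist distributed_borel_measurable by fastforce
  interpret L: product_sigma_finite "\<lambda>_. lborel :: real measure"
    by standard
  have sf: "sigma_finite_measure (density lborel (\<lambda>x. ennreal (g x)))"
  proof -
    obtain i where i: "i \<in> I" using I by auto
    have "prob_space (distr M lborel (Y i))"
      using rv[OF i] by (intro prob_space_distr) simp
    then have "prob_space (density lborel (\<lambda>x. ennreal (g x)))"
      using distributed_distr_eq_density[OF dist[OF i]] by simp
    then show "sigma_finite_measure (density lborel (\<lambda>x. ennreal (g x)))"
      by (simp add: prob_space_imp_sigma_finite)
  qed
  interpret D: product_sigma_finite "\<lambda>_. density lborel (\<lambda>x. ennreal (g x))"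
    using sf by (simp add: product_sigma_finite_def)
  have eq: "distr M (Pi\<^sub>M I (\<lambda>_. borel)) (\<lambda>x. \<lambda>i\<in>I. Y i x) = Pi\<^sub>M I (\<lambda>i. distr M borel (Y i))"
    using indep_vars_iff_distr_eq_PiM'[OF I(2), where X = Y and M' = "\<lambda>_. borel"] rv indep by simp
  have "distr M borel (Y i) = density lborel (\<lambda>x. ennreal (g x))" if "i \<in> I" for i
    using distributed_distr_eq_density[OF dist[OF that]] by (simp cong: distr_cong)
  then have "distr M (Pi\<^sub>M I (\<lambda>_. borel)) (\<lambda>x. \<lambda>i\<in>I. Y i x) = Pi\<^sub>M I (\<lambda>i. density lborel (\<lambda>x. ennreal (g x)))"
    unfolding eq by (intro PiM_cong) auto
  also have "\<dots> = density ?L (\<lambda>x. \<Prod>i\<in>I. ennreal (g (x i)))"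
  proof (rule D.PiM_eqI[OF I(1), symmetric])
    show "sets (density ?L (\<lambda>x. \<Prod>i\<in>I. ennreal (g (x i)))) = sets (Pi\<^sub>M I (\<lambda>_. density lborel (\<lambda>x. ennreal (g x))))"
      by (simp cong: sets_PiM_cong)
  next
    fix B assume B: "\<And>i. i \<in> I \<Longrightarrow> B i \<in> sets (density lborel (\<lambda>x. ennreal (g x)))"
    then have B'[measurable]: "\<And>i. i \<in> I \<Longrightarrow> B i \<in> sets borel" by simp
    have "emeasure (density ?L (\<lambda>x. \<Prod>i\<in>I. ennreal (g (x i)))) (Pi\<^sub>E I B)
       = (\<integral>\<^sup>+x. (\<Prod>i\<in>I. ennreal (g (x i))) * indicator (Pi\<^sub>E I B) x \<partial>?L)"
      using I by (intro emeasure_density) (auto intro!: sets_PiM_I_finite borel_measurable_prod_ennreal)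
    also have "\<dots> = (\<integral>\<^sup>+x. (\<Prod>i\<in>I. ennreal (g (x i)) * indicator (B i) (x i)) \<partial>?L)"
    proof (intro nn_integral_cong)
      fix x assume "x \<in> space ?L"
      then have "indicator (Pi\<^sub>E I B) x = (\<Prod>i\<in>I. indicator (B i) (x i) :: ennreal)"
        using I by (auto simp: indicator_def space_PiM PiE_def Pi_def)
      then show "(\<Prod>i\<in>I. ennreal (g (x i))) * indicator (Pi\<^sub>E I B) x = (\<Prod>i\<in>I. ennreal (g (x i)) * indicator (B i) (x i))"
        by (simp add: prod.distrib)
    qed
    also have "\<dots> = (\<Prod>i\<in>I. \<integral>\<^sup>+x. ennreal (g x) * indicator (B i) x \<partial>lborel)"
      using I by (intro L.product_nn_integral_prod) auto
    also have "\<dots> = (\<Prod>i\<in>I. emeasure (density lborel (\<lambda>x. ennreal (g x))) (B i))"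
      by (intro prod.cong) (auto simp: emeasure_density)
    finally show "emeasure (density ?L (\<lambda>x. \<Prod>i\<in>I. ennreal (g (x i)))) (Pi\<^sub>E I B)
       = (\<Prod>i\<in>I. emeasure (density lborel (\<lambda>x. ennreal (g x))) (B i))" .
  qed
  finally have law: "distr M (Pi\<^sub>M I (\<lambda>_. borel)) (\<lambda>x. \<lambda>i\<in>I. Y i x) = density ?L (\<lambda>x. \<Prod>i\<in>I. ennreal (g (x i)))" .
  have sb: "sets ?L = sets (Pi\<^sub>M I (\<lambda>_. borel))" by (simp cong: sets_PiM_cong)
  have "emeasure M {\<omega> \<in> space M. (\<lambda>i\<in>I. Y i \<omega>) \<in> A} = emeasure (distr M (Pi\<^sub>M I (\<lambda>_. borel)) (\<lambda>x. \<lambda>i\<in>I. Y i x)) A"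
    using A rv unfolding sb
    by (subst emeasure_distr) (auto intro!: measurable_restrict arg_cong[where f="emeasure M"])
  also have "\<dots> = (\<integral>\<^sup>+x. (\<Prod>i\<in>I. ennreal (g (x i))) * indicator A x \<partial>?L)"
    unfolding law using A I by (intro emeasure_density) (auto intro!: borel_measurable_prod_ennreal)
  finally show ?thesis
    by (simp add: prod_ennreal g)
qed

lemma sample_shift:
  assumes "1 \<le> n"
  shows "avg n (\<lambda>i\<in>{1..n}. X i \<omega> + u) = sample_mean X n \<omega> + u"
    and "sd n (\<lambda>i\<in>{1..n}. X i \<omega> + u) = sample_sd X n \<omega>"
proof -
  show avg: "avg n (\<lambda>i\<in>{1..n}. X i \<omega> + u) = sample_mean X n \<omega> + u"
    using assms by (simp add: sample_mean_def sum.distrib add_divide_distrib)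
  have "(\<Sum>i=1..n. ((\<lambda>i\<in>{1..n}. X i \<omega> + u) i - (sample_mean X n \<omega> + u))\<^sup>2)
      = (\<Sum>i=1..n. (X i \<omega> - sample_mean X n \<omega>)\<^sup>2)"
    by (intro sum.cong) auto
  then show "sd n (\<lambda>i\<in>{1..n}. X i \<omega> + u) = sample_sd X n \<omega>"
    by (simp only: sample_sd_def avg)
qed

text \<open>Adding \<open>u\<close> to the mean is the same as adding it to every observation, which leaves the deviation
  unchanged and translates the density.\<close>

lemma (in prob_space) shift_tail_prob_eq_integral:
  fixes X :: "nat \<Rightarrow> 'a \<Rightarrow> real" and f :: "real \<Rightarrow> real"
  assumes indep: "indep_vars (\<lambda>_. borel) X {1..}"
    and dist: "\<And>i. 1 \<le> i \<Longrightarrow> distributed M lborel (X i) (\<lambda>x. ennreal (f x))"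
    and f: "\<And>x. 0 \<le> f x" and n: "1 \<le> n"
  shows "ennreal (shift_tail_prob M X (\<lambda>n. a n * sqrt (real n)) n u) =
    (\<integral>\<^sup>+x. ennreal (\<Prod>i=1..n. f (x i - u)) * indicator (student_cone n (a n)) x \<partial>lebesgue_prod n)"
proof -
  have ind: "indep_vars (\<lambda>_. borel) (\<lambda>i \<omega>. X i \<omega> + u) {1..n}"
    by (rule indep_vars_compose2[OF indep_vars_subset[OF indep]]) auto
  have dist_u: "distributed M lborel (\<lambda>\<omega>. X i \<omega> + u) (\<lambda>x. ennreal (f (x - u)))" if "i \<in> {1..n}" for i
    by (rule distributed_affineI[where t = u and c = 1]) (use dist[of i] that in auto)
  have ev: "{\<omega> \<in> space M. sqrt (real n) * (sample_mean X n \<omega> + u) \<ge> a n * sqrt (real n) * sample_sd X n \<omega>}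
    = {\<omega> \<in> space M. (\<lambda>i\<in>{1..n}. X i \<omega> + u) \<in> student_cone n (a n)}"
  proof -
    have "a n * sqrt (real n) * s \<le> sqrt (real n) * m \<longleftrightarrow> a n * s \<le> m" for s m
      using n mult_le_cancel_left_pos[of "sqrt (real n)" "a n * s" m] by (simp add: mult_ac)
    then show ?thesis
      using sample_shift[OF n, of X _ u] by (auto simp: student_cone_def space_PiM)
  qed
  have "ennreal (shift_tail_prob M X (\<lambda>n. a n * sqrt (real n)) n u)
     = emeasure M {\<omega> \<in> space M. (\<lambda>i\<in>{1..n}. X i \<omega> + u) \<in> student_cone n (a n)}"
    unfolding shift_tail_prob_def ev by (simp add: emeasure_eq_measure)
  also have "\<dots> = (\<integral>\<^sup>+x. ennreal (\<Prod>i=1..n. f (x i - u)) * indicator (student_cone n (a n)) x \<partial>lebesgue_prod n)"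
    using n f by (intro emeasure_joint_density[OF ind dist_u]) auto
  finally show ?thesis .
qed

lemma (in prob_space) shift_tail_event:
  fixes X :: "nat \<Rightarrow> 'a \<Rightarrow> real"
  assumes "\<And>i. 1 \<le> i \<Longrightarrow> X i \<in> borel_measurable M"
  shows "{\<omega> \<in> space M. sqrt (real n) * (sample_mean X n \<omega> + u) \<ge> x n * sample_sd X n \<omega>} \<in> events"
proof -
  have [measurable]: "X i \<in> borel_measurable M" if "i \<in> {1..n}" for i
    using assms that by auto
  show ?thesis
    unfolding sample_sd_def sample_mean_def by measurable
qed

lemma (in prob_space) shift_tail_prob_mono:
  assumes "\<And>i. 1 \<le> i \<Longrightarrow> X i \<in> borel_measurable M" and "u \<le> v"
  shows "shift_tail_prob M X x n u \<le> shift_tail_prob M X x n v"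
  unfolding shift_tail_prob_def
proof (rule finite_measure_mono)
  show "{\<omega> \<in> space M. sqrt (real n) * (sample_mean X n \<omega> + u) \<ge> x n * sample_sd X n \<omega>}
      \<subseteq> {\<omega> \<in> space M. sqrt (real n) * (sample_mean X n \<omega> + v) \<ge> x n * sample_sd X n \<omega>}"
    using assms(2) by (auto elim!: order_trans intro!: mult_left_mono)
qed (rule shift_tail_event[OF assms(1)])

text \<open>The events decrease to the event at \<open>u = 0\<close> as \<open>u\<close> decreases to 0, since the inequality is not
  strict; so the probability is right-continuous at 0.\<close>

lemma (in prob_space) shift_tail_prob_right_continuous:
  assumes X: "\<And>i. 1 \<le> i \<Longrightarrow> X i \<in> borel_measurable M" and r: "shift_tail_prob M X x n 0 < r"
  shows "\<forall>\<^sub>F u in at_right 0. shift_tail_prob M X x n u < r"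
proof -
  define A where "A = (\<lambda>u. {\<omega> \<in> space M. sqrt (real n) * (sample_mean X n \<omega> + u) \<ge> x n * sample_sd X n \<omega>})"
  have A: "shift_tail_prob M X x n u = measure M (A u)" for u
    by (simp add: shift_tail_prob_def A_def)
  have mono: "A u \<subseteq> A v" if "u \<le> v" for u v
    using that by (auto simp: A_def elim!: order_trans intro!: mult_left_mono)
  have Inter: "(\<Inter>k. A (inverse (real (Suc k)))) = A 0"
  proof
    show "A 0 \<subseteq> (\<Inter>k. A (inverse (real (Suc k))))" by (intro INT_greatest mono) simp
    show "(\<Inter>k. A (inverse (real (Suc k)))) \<subseteq> A 0"
    proof
      fix \<omega> assume \<omega>: "\<omega> \<in> (\<Inter>k. A (inverse (real (Suc k))))"
      have "(\<lambda>k. sqrt (real n) * (sample_mean X n \<omega> + inverse (real (Suc k)))) \<longlonglongrightarrow> sqrt (real n) * (sample_mean X n \<omega> + 0)"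
        by (intro tendsto_intros LIMSEQ_inverse_real_of_nat)
      then have "x n * sample_sd X n \<omega> \<le> sqrt (real n) * (sample_mean X n \<omega> + 0)"
        by (rule LIMSEQ_le_const) (use \<omega> in \<open>auto simp: A_def\<close>)
      then show "\<omega> \<in> A 0" using \<omega> by (auto simp: A_def)
    qed
  qed
  have "(\<lambda>k. measure M (A (inverse (real (Suc k))))) \<longlonglongrightarrow> measure M (\<Inter>k. A (inverse (real (Suc k))))"
  proof (rule finite_Lim_measure_decseq)
    show "range (\<lambda>k. A (inverse (real (Suc k)))) \<subseteq> events"
      unfolding A_def using shift_tail_event[OF X] by auto
    show "decseq (\<lambda>k. A (inverse (real (Suc k))))"
      by (intro decseq_SucI mono) simp
  qed
  then have "\<forall>\<^sub>F k in sequentially. measure M (A (inverse (real (Suc k)))) < r"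
    using r unfolding Inter A by (rule order_tendstoD)
  then obtain k where k: "measure M (A (inverse (real (Suc k)))) < r"
    by (auto simp: eventually_sequentially)
  have "\<forall>\<^sub>F u in at_right 0. u < inverse (real (Suc k))"
    by (rule order_tendstoD[OF tendsto_ident_at]) simp
  then show ?thesis
  proof eventually_elim
    case (elim u)
    have "shift_tail_prob M X x n u \<le> shift_tail_prob M X x n (inverse (real (Suc k)))"
      using elim by (intro shift_tail_prob_mono X) auto
    then show ?case using k by (simp add: A)
  qed
qed

section \<open>Inverting the ratio asymptotics\<close>

text \<open>Put \<open>L = z ln c\<close>. For \<open>t > L\<close> the index \<open>n = \<lceil>t / u\<rceil>\<close> is large and by monotonicity already
  satisfies \<open>R n u \<ge> c\<close>. For \<open>t < L\<close> no \<open>n \<le> t / u\<close> does: large \<open>n\<close> are excluded by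
  monotonicity and the limit, the finitely many others because \<open>u\<close> is small.\<close>

lemma first_passage_asymptotics:
  fixes R :: "nat \<Rightarrow> real \<Rightarrow> real" and c z :: real
  assumes mono: "\<And>n u v. u \<le> v \<Longrightarrow> R n u \<le> R n v"
    and fixed: "\<And>n. \<forall>\<^sub>F u in at_right 0. R n u < c"
    and lim: "\<And>t. 0 < t \<Longrightarrow> (\<lambda>n. R n (t / real n)) \<longlonglongrightarrow> exp (t / z)"
    and z: "0 < z" and c: "1 < c"
  shows "\<forall>\<^sub>F u in at_right 0. \<exists>n\<ge>1. c \<le> R n u"
    and "(\<lambda>u. real (LEAST n. 1 \<le> n \<and> c \<le> R n u)) \<sim>[at_right 0] (\<lambda>u. z / u * ln c)"
proof -
  define L where "L = z * ln c"
  have L: "0 < L" using z c by (simp add: L_def)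
  have cL: "c = exp (L / z)" using z c by (simp add: L_def)
  let ?k = "\<lambda>u. LEAST n. 1 \<le> n \<and> c \<le> R n u"
  have upos: "\<forall>\<^sub>F u in at_right (0::real). 0 < u"
    by (rule eventually_at_right_less)
  have small: "\<forall>\<^sub>F u in at_right (0::real). u < d" if "0 < d" for d
    by (rule order_tendstoD[OF tendsto_ident_at]) (use that in simp)
  have upper: "\<forall>\<^sub>F u in at_right 0. \<exists>n\<ge>1. c \<le> R n u \<and> u * real n \<le> t + u" if t: "L < t" for t
  proof -
    have "c < exp (t / z)" unfolding cL using t z by (simp add: divide_strict_right_mono)
    then have "\<forall>\<^sub>F n in sequentially. c < R n (t / real n)"
      using lim[of t] L t by (intro order_tendstoD) auto
    then obtain N where N: "\<And>n. N \<le> n \<Longrightarrow> c < R n (t / real n)"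
      by (auto simp: eventually_sequentially)
    have "0 < t / real (Suc N)" using L t by simp
    from upos small[OF this] show ?thesis
    proof eventually_elim
      case (elim u)
      define n where "n = nat \<lceil>t / u\<rceil>"
      have tu: "0 < t / u" using elim L t by simp
      have n: "t / u \<le> real n" "real n \<le> t / u + 1"
        using tu unfolding n_def by linarith+
      have "real (Suc N) < t / u" using elim by (simp add: field_simps)
      then have "N \<le> n" "1 \<le> n" using n(1) by linarith+
      moreover have "t / real n \<le> u"
        using n(1) elim \<open>1 \<le> n\<close> by (simp add: field_simps)
      then have "R n (t / real n) \<le> R n u" by (rule mono)
      moreover have "u * real n \<le> t + u"
        using mult_left_mono[OF n(2), of u] elim by (simp add: distrib_left)
      ultimately show ?case using N[of n] by (intro exI[of _ n]) auto
    qed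
  qed
  have lower: "\<forall>\<^sub>F u in at_right 0. \<forall>n\<ge>1. c \<le> R n u \<longrightarrow> t < u * real n" if t: "0 < t" "t < L" for t
  proof -
    have "exp (t / z) < c" unfolding cL using t z by (simp add: divide_strict_right_mono)
    then have "\<forall>\<^sub>F n in sequentially. R n (t / real n) < c"
      using lim[of t] t by (intro order_tendstoD) auto
    then obtain N where N: "\<And>n. N \<le> n \<Longrightarrow> R n (t / real n) < c"
      by (auto simp: eventually_sequentially)
    have "\<forall>\<^sub>F u in at_right 0. \<forall>n\<in>{..<N}. R n u < c"
      using fixed by (intro eventually_ball_finite) auto
    with upos show ?thesis
    proof eventually_elim
      case (elim u)
      show ?case
      proof (intro allI impI)
        fix n assume n: "1 \<le> n" "c \<le> R n u"
        then have Nn: "N \<le> n" using elim(2) by (meson lessThan_iff not_le)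
        show "t < u * real n"
        proof (rule ccontr)
          assume "\<not> t < u * real n"
          then have "u \<le> t / real n" using n by (simp add: field_simps)
          then have "R n u \<le> R n (t / real n)" by (rule mono)
          then show False using N[OF Nn] n by linarith
        qed
      qed
    qed
  qed
  have ex: "\<forall>\<^sub>F u in at_right 0. \<exists>n\<ge>1. c \<le> R n u"
    using upper[of "L + 1"] by (auto elim!: eventually_mono)
  then show "\<forall>\<^sub>F u in at_right 0. \<exists>n\<ge>1. c \<le> R n u" .
  have "((\<lambda>u. u * real (?k u)) \<longlongrightarrow> L) (at_right 0)"
  proof (rule order_tendstoI)
    fix l assume l: "l < L"
    define t where "t = (max l 0 + L) / 2"
    have t: "0 < t" "t < L" "l < t" using l L by (auto simp: t_def max_def)
    from ex lower[OF t(1,2)] show "\<forall>\<^sub>F u in at_right 0. l < u * real (?k u)"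
    proof eventually_elim
      case (elim u)
      have "1 \<le> ?k u \<and> c \<le> R (?k u) u"
        using elim(1) by (rule LeastI_ex)
      then have "t < u * real (?k u)" using elim(2) by blast
      then show ?case using t(3) by linarith
    qed
  next
    fix r assume r: "L < r"
    define t where "t = (L + r) / 2"
    have t: "L < t" "0 < r - t" using r by (auto simp: t_def)
    from upos upper[OF t(1)] small[OF t(2)] show "\<forall>\<^sub>F u in at_right 0. u * real (?k u) < r"
    proof eventually_elim
      case (elim u)
      then obtain n where n: "1 \<le> n" "c \<le> R n u" "u * real n \<le> t + u" by blast
      have "?k u \<le> n" using n(1,2) by (simp add: Least_le)
      then have "u * real (?k u) \<le> u * real n" using elim by (intro mult_left_mono) auto
      then show ?case using n elim by linarith
    qed
  qed
  then have "((\<lambda>u. u * real (?k u) / L) \<longlongrightarrow> L / L) (at_right 0)"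
    by (intro tendsto_intros) (use L in auto)
  \<comment> \<open>At \<open>u = 0\<close> both quotients are 0, so they agree everywhere.\<close>
  then have "((\<lambda>u. real (?k u) / (z / u * ln c)) \<longlongrightarrow> 1) (at_right 0)"
    using z c by (simp add: L_def mult.commute mult.left_commute)
  then show "(\<lambda>u. real (?k u)) \<sim>[at_right 0] (\<lambda>u. z / u * ln c)"
    by (rule asymp_equivI')
qed

theorem corollary1p1:
  fixes M :: "'a measure" and X :: "nat \<Rightarrow> 'a \<Rightarrow> real" and f :: "real \<Rightarrow> real"
    and z\<^sub>0 p \<alpha> :: real and a :: "nat \<Rightarrow> real"
  assumes "prob_space M"
    and "prob_space.indep_vars M (\<lambda>_. borel) X {1..}"
    and "\<And>i. i \<ge> 1 \<Longrightarrow> distributed M lborel (X i) (\<lambda>x. ennreal (f x))"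
    and "\<P>(\<omega> in M. X 1 \<omega> > 0) > 0"
    and "bounded (range f)" and "continuous_on UNIV f"
    and "\<exists>\<gamma>>0. Limsup at_top (\<lambda>x. ereal (x powr (1 + \<gamma>) * f x)) < \<infinity>"
    and "z\<^sub>0 > 0"
    and "\<And>z. is_arg_max (\<lambda>z. z * f z) (\<lambda>_. True) z \<longleftrightarrow> z = z\<^sub>0"
    and "\<And>x. f x > 0"
    and "\<And>k x. k < 3 \<Longrightarrow> (deriv ^^ k) (\<lambda>t. ln (f t)) differentiable (at x)"
    and "bounded (range ((deriv ^^ 2) (\<lambda>t. ln (f t))))"
    and "bounded (range ((deriv ^^ 3) (\<lambda>t. ln (f t))))"
    and "filterlim a at_top sequentially"
    and "(\<lambda>n. a n ^ 4) \<in> o(\<lambda>n. real n / ln (real n))"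
    and "0 < p" "p < 1" and "0 < \<alpha>" "\<alpha> < 1"
    and "(1 / p - 1) * (1 / \<alpha> - 1) > 1"
  shows "(\<forall>\<^sub>F u in at_right 0. \<exists>n\<ge>1.
            tail_ratio M X (\<lambda>n. a n * sqrt (real n)) n u \<ge> (1 / p - 1) * (1 / \<alpha> - 1)) \<and>
         (\<lambda>u. real (k_star M X (\<lambda>n. a n * sqrt (real n)) ((1 / p - 1) * (1 / \<alpha> - 1)) u))
           \<sim>[at_right 0] (\<lambda>u. z\<^sub>0 / u * ln ((1 / p - 1) * (1 / \<alpha> - 1)))"
proof -
  interpret prob_space M by fact
  let ?h = "\<lambda>t. ln (f t)" and ?x = "\<lambda>n. a n * sqrt (real n)" and ?c = "(1 / p - 1) * (1 / \<alpha> - 1)"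
  obtain \<gamma> where \<gamma>: "0 < \<gamma>" "Limsup at_top (\<lambda>x. ereal (x powr (1 + \<gamma>) * f x)) < \<infinity>"
    using assms(7) by blast
  obtain C where C: "\<And>x. f x \<le> C * (1 + max x 0) powr - (1 + \<gamma>)"
    using polynomial_tail_bound[OF assms(5,10) \<gamma>] by blast
  have D: "((deriv ^^ k) ?h has_real_derivative (deriv ^^ Suc k) ?h x) (at x)" if "k < 3" for k x
    using assms(11)[OF that, of x] by (simp add: DERIV_deriv_iff_real_differentiable)
  obtain B2 where B2: "\<And>x. \<bar>(deriv ^^ 2) ?h x\<bar> \<le> B2"
    using assms(12) by (auto simp: bounded_iff)
  obtain B3 where B3: "\<And>x. \<bar>(deriv ^^ 3) ?h x\<bar> \<le> B3"
    using assms(13) by (auto simp: bounded_iff)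
  have maximizer: "z * f z < z\<^sub>0 * f z\<^sub>0" if "z \<noteq> z\<^sub>0" for z
  proof (rule ccontr)
    assume le: "\<not> z * f z < z\<^sub>0 * f z\<^sub>0"
    have "\<not> z\<^sub>0 * f z\<^sub>0 < y * f y" for y
      using assms(9)[of z\<^sub>0] by (auto simp: is_arg_max_def)
    then have "is_arg_max (\<lambda>z. z * f z) (\<lambda>_. True) z"
      using le by (auto simp: is_arg_max_def) (meson not_le order_trans)
    then show False using that assms(9) by blast
  qed
  interpret log_smooth_density f "deriv ?h" "(deriv ^^ 2) ?h" "(deriv ^^ 3) ?h" B2 B3 C \<gamma> z\<^sub>0
  proof
    fix x
    show "(?h has_real_derivative deriv ?h x) (at x)"
      "(deriv ?h has_real_derivative (deriv ^^ 2) ?h x) (at x)"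
      "((deriv ^^ 2) ?h has_real_derivative (deriv ^^ 3) ?h x) (at x)"
      using D[of 0 x] D[of "Suc 0" x] D[of 2 x] by (simp_all add: numeral_2_eq_2 numeral_3_eq_3)
  qed (use assms(8,10) \<gamma> C B2 B3 maximizer in auto)
  let ?P = "shift_tail_prob M X ?x"
  have X: "X i \<in> borel_measurable M" if "1 \<le> i" for i
    using distributed_measurable[OF assms(3)[OF that]] by simp
  have P_nonneg: "0 \<le> ?P n u" for n u by (simp add: shift_tail_prob_def)
  have cone_mass: "cone_mass n (a n) u UNIV = ennreal (?P n u)" if "1 \<le> n" for n u
    using shift_tail_prob_eq_integral[OF assms(2,3) less_imp_le[OF f_pos] that, of a u]
    by (simp add: cone_mass_def)
  have lim: "(\<lambda>n. tail_ratio M X ?x n (t / real n)) \<longlonglongrightarrow> exp (t / z\<^sub>0)" if "0 < t" for t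
    unfolding tail_ratio_def
    by (rule shifted_probability_ratio[OF assms(14) less_imp_le[OF that] cone_mass P_nonneg])
  have mono: "tail_ratio M X ?x n u \<le> tail_ratio M X ?x n v" if "u \<le> v" for n u v
    unfolding tail_ratio_def using that
    by (intro divide_right_mono shift_tail_prob_mono X P_nonneg) auto
  \<comment> \<open>If the denominator vanishes, the ratio is 0 because division by 0 gives 0.\<close>
  have fixed: "\<forall>\<^sub>F u in at_right 0. tail_ratio M X ?x n u < ?c" for n
  proof (cases "?P n 0 = 0")
    case True
    then show ?thesis using assms(20) by (simp add: tail_ratio_def)
  next
    case False
    then have P0: "0 < ?P n 0" using P_nonneg[of n 0] by linarith
    then have "?P n 0 < ?c * ?P n 0" using assms(20) by simp
    then have "\<forall>\<^sub>F u in at_right 0. ?P n u < ?c * ?P n 0"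
      by (intro shift_tail_prob_right_continuous X)
    then show ?thesis
      by eventually_elim (use P0 in \<open>simp add: tail_ratio_def divide_less_eq\<close>)
  qed
  show ?thesis
    unfolding k_star_def
    using first_passage_asymptotics[of "tail_ratio M X ?x" ?c z\<^sub>0, OF mono fixed lim assms(8,20)]
    by blast
qed

end
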